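(* Assume the setting and notation of the context, with $B>1$, $B>B_0$, and $\mathbf W\succ\mathbf 0$. For $\theta,v\in\mathbb R^{d_\theta}$ let $\mathcal L_\theta(v)=\mathbb E_\theta^{(N)}[\ell(v)]$ and $\mathcal E_{\mathcal L}(v,\theta)=\mathcal L_\theta(v)-\mathcal L_\theta(\theta)$. Let $\mathcal A_N$ be the set of all maps $\hat\theta:\mathcal Y_N\to\mathbb R^{d_\theta}$ with $\sup_{\theta\in\Theta_B}\mathbb E_\theta^{(N)}[\mathcal E_{\mathcal L}(\hat\theta,\theta)]<\infty$. Then there is an absolute constant $c_0>0$ such that $$\inf_{\hat\theta\in\mathcal A_N}\ \sup_{\theta\in\Theta_B}\ \mathbb E_\theta^{(N)}\big[\mathcal E_{\mathcal L}(\hat\theta,\theta)\big]\ \ge\ c_0\,\frac{d_\theta}{B}\min\Big\{\frac1N,\ \frac{\log^2(B/B_0)}{4\mu_Qd_\theta\log(4d)}\Big\},$$ and moreover $$\inf_{\hat\theta\in\mathcal A_N}\ \sup_{\theta\in\Theta_B}\ \mathbb P_\theta^{(N)}\Big\{\mathcal E_{\mathcal L}(\hat\theta,\theta)\ \ge\ \frac{d_\theta}{128B}\min\Big\{\frac1N,\ \frac{\log^2(B/B_0)}{4\mu_Qd_\theta\log(4d)}\Big\}\Big\}\ \ge\ \frac1{15}.$$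
   Context: Model (Bradley–Terry–Luce with linear-in-parameter utility). Fix an integer $d\ge2$, feature vectors $\phi(\mathbf x_1),\dots,\phi(\mathbf x_d)\in\mathbb R^p$, the matrix $\mathfrak A\in\mathbb R^{d\times p}$ with rows $\phi(\mathbf x_i)^\top$, a scale $\sigma>0$, and a consistent linear system $\mathbf A\mathbf w=\mathbf b$ with $\mathbf A\in\mathbb R^{l\times p}$, $\mathbf b\in\mathbb R^l$. Let $r_A=\mathrm{rank}(\mathbf A)$, $d_\theta=p-r_A\ge1$, let $\mathbf V\in\mathbb R^{p\times d_\theta}$ have orthonormal columns spanning $\mathrm{Null}(\mathbf A)$, and $\mathbf w_o=\mathbf A^\dagger\mathbf b$. Feasible parameters are $\mathbf w=\mathbf w_o+\mathbf V\theta$, $\theta\in\mathbb R^{d_\theta}$. Design: a nonempty set of queries $\mathcal E_s\subseteq\{(i,j):1\le i<j\le d\}$ and integers $n_\alpha\ge1$ ($\alpha\in\mathcal E_s$); $N=\sum_{\alpha\in\mathcal E_s}n_\alpha$. For $\alpha=(i,j)$: $\mathbf a_\alpha=\mathfrak A^\top(\mathbf e_i-\mathbf e_j)$, $\mathbf q_\alpha=\mathbf V^\top\mathbf a_\alpha$, $\eta_\alpha(\theta)=(\mathbf w_o^\top\mathbf a_\alpha+\mathbf q_\alpha^\top\theta)/\sigma$. Responses: $Y^{(N)}=(Y_\alpha^{(t)})_{\alpha\in\mathcal E_s,t\in[n_\alpha]}\in\mathcal Y_N:=\{0,1\}^N$. Under $\mathbb P_\theta^{(N)}$ (expectation $\mathbb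 E_\theta^{(N)}$) the coordinates are independent and $Y_\alpha^{(t)}$ is Bernoulli with success probability $1/(1+e^{-\eta_\alpha(\theta)})$. An estimator $\hat\theta$ means $\hat\theta(Y^{(N)})$; in $\mathcal E_{\mathcal L}(\hat\theta,\theta)$ one substitutes $v=\hat\theta(Y^{(N)})$ into the deterministic function $\mathcal E_{\mathcal L}(\cdot,\theta)$. Negative log-likelihood: with $\Psi(\eta)=\log(1+e^\eta)$ and $Y_\alpha=\sum_{t=1}^{n_\alpha}Y_\alpha^{(t)}$, $\ \ell(\theta)=\frac1N\sum_{\alpha\in\mathcal E_s}\big[-Y_\alpha\eta_\alpha(\theta)+n_\alpha\Psi(\eta_\alpha(\theta))\big]$. Design matrix: $\mathbf W=\frac1N\sum_{\alpha\in\mathcal E_s}n_\alpha\mathbf q_\alpha\mathbf q_\alpha^\top\in\mathbb R^{d_\theta\times d_\theta}$. Coherence level (when $\mathbf W\succ\mathbf 0$): $\mu_Q=\max_{\alpha\in\mathcal E_s}\frac1{d_\theta}\mathbf q_\alpha^\top\mathbf W^{-1}\mathbf q_\alpha$. Parameter set: $\Theta_B=\{\theta\in\mathbb R^{d_\theta}:|\eta_\alpha(\theta)|\le\log B\ \forall\alpha\in\mathcal E_s\}$. The constant $B_0$ is defined by $\log B_0=\max_{\alpha\in\mathcal E_s}|\mathbf w_o^\top\mathbf a_\alpha/\sigma|$. "Absolute constant" means a number independent of all quantities in the problem. *)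

theory Defs
  imports
    "HOL-Probability.Probability"
    "Jordan_Normal_Form.DL_Rank"
    "Jordan_Normal_Form.Matrix_Kernel"
    "Jordan_Normal_Form.Gauss_Jordan_Elimination"
begin

text \<open>
  The absolute constant of the main statement has to be chosen before all dimensions, so vectors
  and matrices are those of Jordan_Normal_Form, whose dimensions are natural numbers; the
  type-indexed vectors of HOL-Analysis, which use the same notation, are hidden.
\<close>

hide_type (open) Finite_Cartesian_Product.vec
hide_const (open) Finite_Cartesian_Product.vec Finite_Cartesian_Product.mat
  Finite_Cartesian_Product.row Finite_Cartesian_Product.rows
  Finite_Cartesian_Product.column Finite_Cartesian_Product.columns
  Finite_Cartesian_Product.transpose
no_notation Finite_Cartesian_Product.vec_nth (infixl \<open>$\<close> 90)
no_notation inner (infix \<open>\<bullet>\<close> 70)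


subsection \<open>Matrices\<close>

text \<open>The four Penrose conditions.\<close>

definition is_pinv :: "real mat \<Rightarrow> real mat \<Rightarrow> bool" where
  "is_pinv A P \<longleftrightarrow>
     P \<in> carrier_mat (dim_col A) (dim_row A) \<and>
     A * P * A = A \<and> P * A * P = P \<and>
     (A * P)\<^sup>T = A * P \<and> (P * A)\<^sup>T = P * A"

definition pinv :: "real mat \<Rightarrow> real mat" where
  "pinv A = (THE P. is_pinv A P)"

lemma is_pinv_unique:
  assumes X: "is_pinv A X" and Y: "is_pinv A Y"
  shows "X = Y"
proof -
  define m n where "m = dim_row A" and "n = dim_col A"
  have A: "A \<in> carrier_mat m n" unfolding m_def n_def by (rule carrier_matI) (rule refl)+
  have Xc: "X \<in> carrier_mat n m" and Yc: "Y \<in> carrier_mat n m"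
    unfolding m_def n_def
    using X[unfolded is_pinv_def, THEN conjunct1] Y[unfolded is_pinv_def, THEN conjunct1] .
  have AX: "A * X \<in> carrier_mat m m" and AY: "A * Y \<in> carrier_mat m m"
    and XA: "X * A \<in> carrier_mat n n" and YA: "Y * A \<in> carrier_mat n n"
    using A Xc Yc by (auto intro: mult_carrier_mat)
  have x: "A * X * A = A" "X * A * X = X" "(A * X)\<^sup>T = A * X" "(X * A)\<^sup>T = X * A"
    using X unfolding is_pinv_def by blast+
  have y: "A * Y * A = A" "Y * A * Y = Y" "(A * Y)\<^sup>T = A * Y" "(Y * A)\<^sup>T = Y * A"
    using Y unfolding is_pinv_def by blast+
  have e: "A * Y * (A * X) = A * X" "A * X * (A * Y) = A * Y"
    using assoc_mult_mat[OF AY A Xc] assoc_mult_mat[OF AX A Yc] by (simp_all only: x(1) y(1))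
  have eq1: "A * X = A * Y"
    using transpose_mult[OF AY AX] by (simp only: e x(3) y(3))
  have "A * (X * A) = A" "A * (Y * A) = A"
    using assoc_mult_mat[OF A Xc A] assoc_mult_mat[OF A Yc A] by (simp_all only: x(1) y(1))
  then have f: "X * A * (Y * A) = X * A" "Y * A * (X * A) = Y * A"
    using assoc_mult_mat[OF Xc A YA] assoc_mult_mat[OF Yc A XA] by (simp_all only:)
  have eq2: "X * A = Y * A"
    using transpose_mult[OF XA YA] by (simp only: f x(4) y(4))
  have "X = X * A * X" by (rule x(2)[symmetric])
  also have "\<dots> = Y * (A * X)" unfolding eq2 using Yc A Xc by (rule assoc_mult_mat)
  also have "\<dots> = Y * A * Y" unfolding eq1 using Yc A Yc by (rule assoc_mult_mat[symmetric])
  also have "\<dots> = Y" by (rule y(2))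
  finally show ?thesis .
qed

lemma pinv_eqI: "is_pinv A P \<Longrightarrow> pinv A = P"
  unfolding pinv_def using is_pinv_unique by blast

definition pos_def_mat :: "nat \<Rightarrow> real mat \<Rightarrow> bool" where
  "pos_def_mat n W \<longleftrightarrow> W \<in> carrier_mat n n \<and> W\<^sup>T = W \<and>
     (\<forall>v \<in> carrier_vec n. v \<noteq> 0\<^sub>v n \<longrightarrow> 0 < v \<bullet> (W *\<^sub>v v))"


subsection \<open>The constrained Bradley--Terry--Luce model\<close>

text \<open>
  Items are numbered from \<open>0\<close>, so queries are pairs \<open>(i, j)\<close> with \<open>i < j < n_items\<close>.
  The values of \<^term>\<open>reps\<close> outside \<^term>\<open>queries\<close> are irrelevant.
\<close>

record btl =
  n_items :: nat
  n_feat :: nat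
  n_constr :: nat
  feat :: "nat \<Rightarrow> real vec"
  scale :: real
  lhs :: "real mat"
  rhs :: "real vec"
  null_basis :: "real mat"
  queries :: "(nat \<times> nat) set"
  reps :: "nat \<times> nat \<Rightarrow> nat"

definition feat_mat :: "btl \<Rightarrow> real mat" where
  "feat_mat M = mat_of_rows (n_feat M) (map (feat M) [0..<n_items M])"

definition par_dim :: "btl \<Rightarrow> nat" where
  "par_dim M = n_feat M - vec_space.rank (n_constr M) (lhs M)"

definition btl_setting :: "btl \<Rightarrow> bool" where
  "btl_setting M \<longleftrightarrow>
     n_items M \<ge> 2 \<and>
     (\<forall>i < n_items M. feat M i \<in> carrier_vec (n_feat M)) \<and>
     scale M > 0 \<and>
     lhs M \<in> carrier_mat (n_constr M) (n_feat M) \<and>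
     rhs M \<in> carrier_vec (n_constr M) \<and>
     (\<exists>w \<in> carrier_vec (n_feat M). lhs M *\<^sub>v w = rhs M) \<and>
     par_dim M \<ge> 1 \<and>
     null_basis M \<in> carrier_mat (n_feat M) (par_dim M) \<and>
     (null_basis M)\<^sup>T * null_basis M = 1\<^sub>m (par_dim M) \<and>
     vec_space.col_space (n_feat M) (null_basis M) = mat_kernel (lhs M) \<and>
     queries M \<noteq> {} \<and>
     queries M \<subseteq> {(i, j). i < j \<and> j < n_items M} \<and>
     (\<forall>\<alpha> \<in> queries M. reps M \<alpha> \<ge> 1)"

definition w_o :: "btl \<Rightarrow> real vec" where
  "w_o M = pinv (lhs M) *\<^sub>v rhs M"

definition n_obs :: "btl \<Rightarrow> nat" where
  "n_obs M = (\<Sum>\<alpha> \<in> queries M. reps M \<alpha>)"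

definition contrast :: "btl \<Rightarrow> nat \<times> nat \<Rightarrow> real vec" where
  "contrast M \<alpha> =
     (feat_mat M)\<^sup>T *\<^sub>v (unit_vec (n_items M) (fst \<alpha>) - unit_vec (n_items M) (snd \<alpha>))"

definition qvec :: "btl \<Rightarrow> nat \<times> nat \<Rightarrow> real vec" where
  "qvec M \<alpha> = (null_basis M)\<^sup>T *\<^sub>v contrast M \<alpha>"

definition eta :: "btl \<Rightarrow> nat \<times> nat \<Rightarrow> real vec \<Rightarrow> real" where
  "eta M \<alpha> \<theta> = (w_o M \<bullet> contrast M \<alpha> + qvec M \<alpha> \<bullet> \<theta>) / scale M"

definition design_mat :: "btl \<Rightarrow> real mat" where
  "design_mat M = mat (par_dim M) (par_dim M) (\<lambda>(r, s).
     (1 / real (n_obs M)) *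
     (\<Sum>\<alpha> \<in> queries M. real (reps M \<alpha>) * (qvec M \<alpha> $ r * qvec M \<alpha> $ s)))"

definition coherence :: "btl \<Rightarrow> real" where
  "coherence M = Max ((\<lambda>\<alpha>. (1 / real (par_dim M)) *
     (qvec M \<alpha> \<bullet> (the (mat_inverse (design_mat M)) *\<^sub>v qvec M \<alpha>))) ` queries M)"

definition par_set :: "btl \<Rightarrow> real \<Rightarrow> real vec set" where
  "par_set M B = {\<theta> \<in> carrier_vec (par_dim M). \<forall>\<alpha> \<in> queries M. \<bar>eta M \<alpha> \<theta>\<bar> \<le> ln B}"

definition B0 :: "btl \<Rightarrow> real" where
  "B0 M = exp (Max ((\<lambda>\<alpha>. \<bar>w_o M \<bullet> contrast M \<alpha> / scale M\<bar>) ` queries M))"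


subsection \<open>Responses and loss\<close>

text \<open>
  A response assigns a truth value (success or failure) to every \<open>(\<alpha>, t)\<close>; as usual for
  \<^const>\<open>Pi_pmf\<close>, it is \<^const>\<open>False\<close> off the index set.
\<close>

type_synonym response = "(nat \<times> nat) \<times> nat \<Rightarrow> bool"

definition resp_index :: "btl \<Rightarrow> ((nat \<times> nat) \<times> nat) set" where
  "resp_index M = (SIGMA \<alpha> : queries M. {1..reps M \<alpha>})"

definition resp_space :: "btl \<Rightarrow> response set" where
  "resp_space M = PiE_dflt (resp_index M) False (\<lambda>_. UNIV)"

definition resp_pmf :: "btl \<Rightarrow> real vec \<Rightarrow> response pmf" where
  "resp_pmf M \<theta> = Pi_pmf (resp_index M) False
     (\<lambda>(\<alpha>, t). bernoulli_pmf (1 / (1 + exp (- eta M \<alpha> \<theta>))))"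

definition successes :: "btl \<Rightarrow> response \<Rightarrow> nat \<times> nat \<Rightarrow> real" where
  "successes M y \<alpha> = (\<Sum>t = 1..reps M \<alpha>. of_bool (y (\<alpha>, t)))"

definition Psi :: "real \<Rightarrow> real" where
  "Psi x = ln (1 + exp x)"

definition nll :: "btl \<Rightarrow> response \<Rightarrow> real vec \<Rightarrow> real" where
  "nll M y v = (1 / real (n_obs M)) *
     (\<Sum>\<alpha> \<in> queries M. - successes M y \<alpha> * eta M \<alpha> v + real (reps M \<alpha>) * Psi (eta M \<alpha> v))"

definition pop_loss :: "btl \<Rightarrow> real vec \<Rightarrow> real vec \<Rightarrow> real" where
  "pop_loss M \<theta> v = measure_pmf.expectation (resp_pmf M \<theta>) (\<lambda>y. nll M y v)"

definition excess :: "btl \<Rightarrow> real vec \<Rightarrow> real vec \<Rightarrow> real" where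
  "excess M v \<theta> = pop_loss M \<theta> v - pop_loss M \<theta> \<theta>"

definition risk :: "btl \<Rightarrow> (response \<Rightarrow> real vec) \<Rightarrow> real vec \<Rightarrow> real" where
  "risk M h \<theta> = measure_pmf.expectation (resp_pmf M \<theta>) (\<lambda>y. excess M (h y) \<theta>)"

text \<open>Suprema and infima are taken in \<^typ>\<open>ereal\<close>, where they always exist.\<close>

definition estimators :: "btl \<Rightarrow> real \<Rightarrow> (response \<Rightarrow> real vec) set" where
  "estimators M B = {h \<in> resp_space M \<rightarrow> carrier_vec (par_dim M).
     (SUP \<theta> \<in> par_set M B. ereal (risk M h \<theta>)) < \<infinity>}"

definition rate :: "btl \<Rightarrow> real \<Rightarrow> real" where
  "rate M B = min (1 / real (n_obs M))
     ((ln (B / B0 M))\<^sup>2 / (4 * coherence M * real (par_dim M) * ln (4 * real (n_items M))))"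

end

theory Submission
  imports Defs
begin

text \<open>
  The excess risk is an average of Bregman divergences of \<^const>\<open>Psi\<close>. If \<open>T\<^sup>T W T = 1\<close> for the
  design matrix \<open>W\<close>, then \<open>T T\<^sup>T = W\<^sup>-\<^sup>1\<close>, and the parameters \<open>\<theta>\<^sub>S = \<sigma> \<delta> T s\<close> with sign vectors \<open>s\<close>
  and \<open>\<delta>\<^sup>2\<close> equal to the rate form a hypercube that is isometric up to scaling for the prediction
  distance. By Hoeffding's bound and the coherence, all but a \<open>1/16\<close> fraction of them lie in the
  parameter set. Two admissible \<open>\<theta>\<^sub>S\<close> for which the same estimate has excess risk below the
  threshold differ in less than \<open>d\<^sub>\<theta>/16\<close> signs, so a good estimator would recover most signs.
  But neighbouring vertices have Hellinger affinity at least \<open>exp (-1/8)\<close>, so on average at least a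
  \<open>exp (-1/4)/4\<close> fraction of the signs is wrong (Assouad). Hence the failure probability, averaged
  over the admissible vertices, is at least \<open>exp (-1/4)/4 - 1/16 - 1/16 > 1/15\<close>.
  The bound in expectation then follows from Markov's inequality.
\<close>


subsection \<open>The logistic loss\<close>

definition logistic :: "real \<Rightarrow> real" where
  "logistic x = 1 / (1 + exp (- x))"

text \<open>The Kullback-Leibler divergence KL(P, Q) of the Bernoulli laws P and Q with log-odds
  \<open>y\<close> and \<open>x\<close>.\<close>

definition bregman_Psi :: "real \<Rightarrow> real \<Rightarrow> real" where
  "bregman_Psi x y = Psi x - Psi y - logistic y * (x - y)"

lemma logistic_pos: "0 < logistic x"
  by (simp add: logistic_def add_pos_pos)

lemma logistic_less_1: "logistic x < 1"
  by (simp add: logistic_def add_pos_pos field_simps)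

lemma logistic_altdef: "logistic x = exp x / (1 + exp x)"
proof -
  have "1 + exp x > 0" by (simp add: add_pos_pos)
  moreover have "1 + exp (- x) > 0" by (simp add: add_pos_pos)
  ultimately show ?thesis by (simp add: logistic_def exp_minus field_simps)
qed

lemma one_minus_logistic: "1 - logistic x = 1 / (1 + exp x)"
proof -
  have "1 + exp x > 0" by (simp add: add_pos_pos)
  then show ?thesis by (simp add: logistic_altdef field_simps)
qed

lemma DERIV_Psi: "(Psi has_real_derivative logistic x) (at x)"
proof -
  have "1 + exp x > 0" by (simp add: add_pos_pos)
  then have "((\<lambda>x. ln (1 + exp x)) has_real_derivative exp x / (1 + exp x)) (at x)"
    by (auto intro!: derivative_eq_intros)
  then show ?thesis by (simp add: Psi_def[abs_def] logistic_altdef)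
qed

lemma DERIV_logistic: "(logistic has_real_derivative exp x / (1 + exp x)\<^sup>2) (at x)"
proof -
  have p: "1 + exp x > 0" by (simp add: add_pos_pos)
  then have "((\<lambda>x. exp x / (1 + exp x)) has_real_derivative exp x / (1 + exp x)\<^sup>2) (at x)"
    by (auto intro!: derivative_eq_intros simp: power2_eq_square field_simps)
  then show ?thesis by (simp add: logistic_altdef[abs_def])
qed

lemma mono_logistic: "x \<le> y \<Longrightarrow> logistic x \<le> logistic y"
  by (simp add: logistic_def frac_le add_pos_pos)

text \<open>Curvature at least \<open>c\<close> makes \<open>Psi z - c / 2 * z\<^sup>2\<close>
  convex on \<open>C\<close>, and a convex function lies above its tangent at
  \<open>y\<close>.\<close>

lemma bregman_Psi_ge:
  fixes C :: "real set"
  assumes C: "convex C" and x: "x \<in> C" and y: "y \<in> C"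
    and c: "\<And>z. z \<in> C \<Longrightarrow> c \<le> exp z / (1 + exp z)\<^sup>2"
  shows "c / 2 * (x - y)\<^sup>2 \<le> bregman_Psi x y"
proof -
  let ?g = "\<lambda>z. Psi z - c / 2 * z\<^sup>2" and ?g' = "\<lambda>z. logistic z - c * z"
  have d: "(?g has_real_derivative ?g' z) (at z)" for z
    by (auto intro!: derivative_eq_intros DERIV_Psi)
  have d2: "(?g' has_real_derivative (exp z / (1 + exp z)\<^sup>2 - c)) (at z)" for z
    by (auto intro!: derivative_eq_intros DERIV_logistic)
  have "?g' y * (x - y) \<le> ?g x - ?g y"
    by (rule f''_imp_f'[OF C d d2 _ y x]) (use c in auto)
  then show ?thesis
    by (simp add: bregman_Psi_def power2_eq_square algebra_simps)
qed

text \<open>The curvature of \<open>Psi\<close> never exceeds 1/4, so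
  \<open>z\<^sup>2 / 8 - Psi z\<close> is convex on the whole line.\<close>

lemma bregman_Psi_le: "bregman_Psi x y \<le> (x - y)\<^sup>2 / 8"
proof -
  let ?g = "\<lambda>z. z\<^sup>2 / 8 - Psi z" and ?g' = "\<lambda>z. z / 4 - logistic z"
  have d: "(?g has_real_derivative ?g' z) (at z)" for z
    by (auto intro!: derivative_eq_intros DERIV_Psi)
  have d2: "(?g' has_real_derivative (1 / 4 - exp z / (1 + exp z)\<^sup>2)) (at z)" for z
    by (auto intro!: derivative_eq_intros DERIV_logistic)
  have "exp z / (1 + exp z)\<^sup>2 \<le> 1 / 4" for z :: real
  proof -
    have "0 \<le> (1 - exp z)\<^sup>2" by simp
    then have "4 * exp z \<le> (1 + exp z)\<^sup>2"
      by (simp add: power2_eq_square algebra_simps)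
    moreover have "1 + exp z > 0" by (simp add: add_pos_pos)
    ultimately show ?thesis by (simp add: divide_le_eq)
  qed
  then have "?g' y * (x - y) \<le> ?g x - ?g y"
    by (intro f''_imp_f'[OF convex_UNIV d d2]) auto
  then show ?thesis
    by (simp add: bregman_Psi_def power2_eq_square field_simps)
qed

lemma bregman_Psi_nonneg: "0 \<le> bregman_Psi x y"
  using bregman_Psi_ge[of UNIV x y 0] by simp

lemma bregman_Psi_ge_of_bounded:
  assumes B: "1 < B" and x: "\<bar>x\<bar> \<le> ln B" and y: "\<bar>y\<bar> \<le> ln B"
  shows "(x - y)\<^sup>2 / (8 * B) \<le> bregman_Psi x y"
proof -
  \<comment> \<open>On this interval \<open>exp z\<close> and \<open>exp (- z)\<close> are at most
    \<open>B\<close>, so each of the four terms of the expanded square is at most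
    \<open>B * exp z\<close>.\<close>
  have "1 / (4 * B) \<le> exp z / (1 + exp z)\<^sup>2" if z: "z \<in> {- ln B..ln B}" for z
  proof -
    have "exp z \<le> exp (ln B)" "exp (- z) \<le> exp (ln B)" using z by (simp_all only: exp_le_cancel_iff) auto
    then have 1: "exp z \<le> B" and 2: "1 \<le> B * exp z"
      using B by (simp_all add: exp_minus field_simps)
    have "exp z * exp z \<le> B * exp z" using 1 by simp
    moreover have "1 * exp z \<le> B * exp z" using B by (intro mult_right_mono) auto
    moreover have "(1 + exp z)\<^sup>2 = 1 + 2 * exp z + exp z * exp z"
      by (simp add: power2_eq_square algebra_simps)
    ultimately have "(1 + exp z)\<^sup>2 \<le> 4 * (B * exp z)"
      using 2 by linarith
    moreover have "1 + exp z > 0" by (simp add: add_pos_pos)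
    ultimately show ?thesis using B by (simp add: field_simps del: power2_sum)
  qed
  then show ?thesis
    using bregman_Psi_ge[of "{- ln B..ln B}" x y "1 / (4 * B)"] x y by (simp add: field_simps abs_le_iff)
qed

text \<open>
  Here \<open>x\<close> is unrestricted: outside the interval spanned by \<open>y\<close> and \<open>z\<close>, where the curvature
  bound may fail, the divergence from the far endpoint already exceeds that between the endpoints.
\<close>

lemma bregman_Psi_pair:
  assumes B: "1 < B" and y: "\<bar>y\<bar> \<le> ln B" and z: "\<bar>z\<bar> \<le> ln B"
  shows "(y - z)\<^sup>2 / (16 * B) \<le> bregman_Psi x y + bregman_Psi x z"
  using y z
proof (induction y z rule: linorder_wlog)
  case (sym y z)
  then show ?case by (simp add: power2_commute add.commute)
next
  case (le y z)
  have far: "(y - z)\<^sup>2 / (16 * B) \<le> (y - z)\<^sup>2 / (8 * B)"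
    using B by (intro divide_left_mono) auto
  consider "x \<le> y" | "z \<le> x" | "y \<le> x" "x \<le> z" using le by linarith
  then show ?case
  proof cases
    case 1
    \<comment> \<open>Three-point identity: writing D for \<open>bregman_Psi\<close>, this product
      is D(x, z) - D(x, y) - D(y, z).\<close>
    have "(logistic y - logistic z) * (x - y) \<ge> 0"
      using mono_logistic[OF le(1)] 1 by (simp add: mult_nonpos_nonpos)
    then have "bregman_Psi y z \<le> bregman_Psi x z - bregman_Psi x y"
      by (simp add: bregman_Psi_def algebra_simps)
    then show ?thesis
      using far bregman_Psi_ge_of_bounded[OF B le(2,3)] bregman_Psi_nonneg[of x y] by linarith
  next
    case 2
    have "(logistic z - logistic y) * (x - z) \<ge> 0"
      using mono_logistic[OF le(1)] 2 by simp
    then have "bregman_Psi z y \<le> bregman_Psi x y - bregman_Psi x z"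
      by (simp add: bregman_Psi_def algebra_simps)
    then show ?thesis
      using far bregman_Psi_ge_of_bounded[OF B le(3,2)] bregman_Psi_nonneg[of x z]
      by (simp add: power2_commute)
  next
    case 3
    \<comment> \<open>Between the endpoints the curvature bound applies to both divergences;
      splitting the square costs the factor 2 that turns 8 into 16.\<close>
    then have x: "\<bar>x\<bar> \<le> ln B" using le by linarith
    have "(y - z)\<^sup>2 \<le> 2 * ((x - y)\<^sup>2 + (x - z)\<^sup>2)"
      using zero_le_power2[of "(x - y) + (x - z)"] by (simp add: power2_eq_square algebra_simps)
    then have "(y - z)\<^sup>2 / (16 * B) \<le> (x - y)\<^sup>2 / (8 * B) + (x - z)\<^sup>2 / (8 * B)"
      using B by (simp add: field_simps)
    then show ?thesis
      using bregman_Psi_ge_of_bounded[OF B x le(2)] bregman_Psi_ge_of_bounded[OF B x le(3)]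
      by linarith
  qed
qed

section \<open>Two uses of the curvature bound 1/4: random signs and Bernoulli affinity\<close>

text \<open>\<open>bregman_Psi (2 * x) 0\<close> is the logarithm of cosh x, so its quadratic upper
  bound is the sub-Gaussian bound for a random sign.\<close>

lemma exp_plus_exp_minus_le: "exp x + exp (- x) \<le> 2 * exp (x\<^sup>2 / 2)" for x :: real
proof -
  have p: "0 < 1 + exp (2 * x)" by (simp add: add_pos_pos)
  have "bregman_Psi (2 * x) 0 \<le> x\<^sup>2 / 2"
    using bregman_Psi_le[of "2 * x" 0] by simp
  then have "ln (1 + exp (2 * x)) \<le> ln 2 + x + x\<^sup>2 / 2"
    by (simp add: bregman_Psi_def Psi_def logistic_def)
  then have "1 + exp (2 * x) \<le> exp (ln 2 + x + x\<^sup>2 / 2)"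
    using p by (metis exp_le_cancel_iff exp_ln)
  then have "exp (- x) * (1 + exp (2 * x)) \<le> exp (- x) * (2 * exp x * exp (x\<^sup>2 / 2))"
    by (simp add: exp_add)
  then show ?thesis
    by (simp add: distrib_left mult.left_commute flip: exp_add mult.assoc)
qed

text \<open>The Hellinger affinity on the right is \<open>exp (Psi m - (Psi a + Psi b) / 2)\<close>
  with the midpoint \<open>m\<close>. Up to sign, the exponent is half the sum of the divergences of
  \<open>a\<close> and \<open>b\<close> from \<open>m\<close>, because their linear terms
  cancel.\<close>

lemma bernoulli_affinity:
  "exp (- ((a - b)\<^sup>2 / 32))
     \<le> sqrt (logistic a * logistic b) + sqrt ((1 - logistic a) * (1 - logistic b))"
proof -
  define m where "m = (a + b) / 2"
  have p: "0 < 1 + exp a" "0 < 1 + exp b" "0 < 1 + exp m" by (simp_all add: add_pos_pos)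
  have "bregman_Psi a m + bregman_Psi b m \<le> (a - b)\<^sup>2 / 16"
    using bregman_Psi_le[of a m] bregman_Psi_le[of b m]
    by (simp add: m_def power2_eq_square field_simps)
  moreover have "bregman_Psi a m + bregman_Psi b m = Psi a + Psi b - 2 * Psi m"
    by (simp add: bregman_Psi_def m_def field_simps)
  ultimately have "- ((a - b)\<^sup>2 / 32) \<le> Psi m - (Psi a + Psi b) / 2"
    by (simp add: field_simps del: power2_diff)
  then have "exp (- ((a - b)\<^sup>2 / 32)) \<le> exp (Psi m - (Psi a + Psi b) / 2)" by simp
  also have "\<dots> = (1 + exp m) / sqrt ((1 + exp a) * (1 + exp b))"
  proof -
    have "sqrt ((1 + exp a) * (1 + exp b)) = exp ((Psi a + Psi b) / 2)"
      by (rule real_sqrt_unique) (use p in \<open>simp_all add: Psi_def power2_eq_square exp_add[of "ln (1 + exp a)"] flip: exp_add[of "_ / 2"]\<close>)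
    then show ?thesis using p by (simp add: Psi_def exp_diff)
  qed
  also have "\<dots> = sqrt (logistic a * logistic b) + sqrt ((1 - logistic a) * (1 - logistic b))"
  proof -
    have "sqrt (exp a * exp b) = exp m"
      by (rule real_sqrt_unique) (simp_all add: m_def power2_eq_square flip: exp_add)
    then have "sqrt (logistic a * logistic b) = exp m / sqrt ((1 + exp a) * (1 + exp b))"
      by (simp add: logistic_altdef real_sqrt_divide)
    moreover have "sqrt ((1 - logistic a) * (1 - logistic b)) = 1 / sqrt ((1 + exp a) * (1 + exp b))"
      by (simp add: one_minus_logistic real_sqrt_divide)
    ultimately show ?thesis by (simp add: add_divide_distrib)
  qed
  finally show ?thesis .
qed

subsection \<open>Random signs and Assouad's lemma\<close>

text \<open>A sign vector is encoded by the set of its positive positions: the cube is a power set,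
  and neighbours are \<open>S\<close> and \<open>insert i S\<close>.\<close>

definition rademacher :: "nat set \<Rightarrow> nat \<Rightarrow> real" where
  "rademacher S i = (if i \<in> S then 1 else - 1)"

text \<open>Independence of the signs takes the form of \<open>prod_add\<close>: the sum over
  subsets factors into a product over coordinates.\<close>

lemma sum_exp_rademacher_le:
  assumes A: "finite A"
  shows "(\<Sum>S\<in>Pow A. exp (\<Sum>i\<in>A. rademacher S i * c i))
           \<le> 2 ^ card A * exp ((\<Sum>i\<in>A. (c i)\<^sup>2) / 2)"
proof -
  have "(\<Sum>S\<in>Pow A. exp (\<Sum>i\<in>A. rademacher S i * c i))
      = (\<Sum>S\<in>Pow A. (\<Prod>i\<in>S. exp (c i)) * (\<Prod>i\<in>A - S. exp (- c i)))"
  proof (rule sum.cong[OF refl])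
    fix S assume "S \<in> Pow A"
    then have S: "S \<subseteq> A" by simp
    have "(\<Prod>i\<in>A. exp (rademacher S i * c i))
        = (\<Prod>i\<in>A - S. exp (rademacher S i * c i)) * (\<Prod>i\<in>S. exp (rademacher S i * c i))"
      using S A by (rule prod.subset_diff)
    also have "\<dots> = (\<Prod>i\<in>A - S. exp (- c i)) * (\<Prod>i\<in>S. exp (c i))"
      by (intro arg_cong2[where f = "(*)"] prod.cong) (auto simp: rademacher_def)
    finally show "exp (\<Sum>i\<in>A. rademacher S i * c i)
        = (\<Prod>i\<in>S. exp (c i)) * (\<Prod>i\<in>A - S. exp (- c i))"
      by (simp add: exp_sum A mult.commute)
  qed
  also have "\<dots> = (\<Prod>i\<in>A. exp (c i) + exp (- c i))"
    using A by (rule prod_add[symmetric])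
  also have "\<dots> \<le> (\<Prod>i\<in>A. 2 * exp ((c i)\<^sup>2 / 2))"
    by (intro prod_mono conjI exp_plus_exp_minus_le) (simp add: add_nonneg_nonneg)
  also have "\<dots> = 2 ^ card A * exp ((\<Sum>i\<in>A. (c i)\<^sup>2) / 2)"
    by (simp add: prod.distrib exp_sum A sum_divide_distrib)
  finally show ?thesis .
qed

text \<open>Chernoff's bound, with counting in place of probability; the factor 2 accounts for the
  two tails.\<close>

lemma card_rademacher_gt_le:
  assumes A: "finite A" and l: "0 \<le> l"
  shows "real (card {S \<in> Pow A. L < \<bar>\<Sum>i\<in>A. rademacher S i * c i\<bar>})
           \<le> 2 * 2 ^ card A * exp (l\<^sup>2 * (\<Sum>i\<in>A. (c i)\<^sup>2) / 2 - l * L)"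
proof -
  let ?f = "\<lambda>S. \<Sum>i\<in>A. rademacher S i * c i"
  have scale: "(\<Sum>i\<in>A. rademacher S i * (k * c i)) = k * ?f S" for S k
    by (simp add: sum_distrib_left mult_ac)
  have mgf: "(\<Sum>S\<in>Pow A. exp (k * ?f S)) \<le> 2 ^ card A * exp (k\<^sup>2 * (\<Sum>i\<in>A. (c i)\<^sup>2) / 2)" for k
    using sum_exp_rademacher_le[OF A, of "\<lambda>i. k * c i"]
    by (simp add: scale power_mult_distrib flip: sum_distrib_left)
  have "real (card {S \<in> Pow A. L < \<bar>?f S\<bar>}) = (\<Sum>S\<in>{S \<in> Pow A. L < \<bar>?f S\<bar>}. 1)"
    by simp
  also have "\<dots> \<le> (\<Sum>S\<in>{S \<in> Pow A. L < \<bar>?f S\<bar>}. exp (- (l * L)) * (exp (l * ?f S) + exp (- l * ?f S)))"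
  proof (rule sum_mono)
    fix S assume "S \<in> {S \<in> Pow A. L < \<bar>?f S\<bar>}"
    then have "l * L \<le> l * \<bar>?f S\<bar>" using l by (intro mult_left_mono) auto
    then have "1 \<le> exp (- (l * L)) * exp (l * \<bar>?f S\<bar>)" by (simp flip: exp_add)
    also have "exp (l * \<bar>?f S\<bar>) \<le> exp (l * ?f S) + exp (- l * ?f S)"
      by (cases "0 \<le> ?f S") (simp_all add: abs_if)
    finally show "1 \<le> exp (- (l * L)) * (exp (l * ?f S) + exp (- l * ?f S))" by simp
  qed
  also have "\<dots> \<le> (\<Sum>S\<in>Pow A. exp (- (l * L)) * (exp (l * ?f S) + exp (- l * ?f S)))"
    using A by (intro sum_mono2) (auto simp: add_nonneg_nonneg)
  also have "\<dots> = exp (- (l * L)) * ((\<Sum>S\<in>Pow A. exp (l * ?f S)) + (\<Sum>S\<in>Pow A. exp (- l * ?f S)))"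
    by (simp add: sum_distrib_left sum.distrib distrib_left)
  also have "\<dots> \<le> exp (- (l * L)) * (2 * 2 ^ card A * exp (l\<^sup>2 * (\<Sum>i\<in>A. (c i)\<^sup>2) / 2))"
    using mgf[of l] mgf[of "- l"] by (intro mult_left_mono) auto
  also have "\<dots> = 2 * 2 ^ card A * exp (l\<^sup>2 * (\<Sum>i\<in>A. (c i)\<^sup>2) / 2 - l * L)"
    by (simp only: mult_ac diff_conv_add_uminus exp_add)
  finally show ?thesis .
qed

text \<open>Le Cam's inequality, from Cauchy--Schwarz for \<open>sqrt (p q) = sqrt (min p q) * sqrt (max p q)\<close>.\<close>

lemma sum_min_pmf_ge:
  assumes fin: "finite \<Omega>" and P: "set_pmf P \<subseteq> \<Omega>" and Q: "set_pmf Q \<subseteq> \<Omega>"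
    and r: "0 \<le> r" "r \<le> (\<Sum>y\<in>\<Omega>. sqrt (pmf P y * pmf Q y))"
  shows "r\<^sup>2 / 2 \<le> (\<Sum>y\<in>\<Omega>. min (pmf P y) (pmf Q y))"
proof -
  let ?m = "\<lambda>y. min (pmf P y) (pmf Q y)" and ?M = "\<lambda>y. max (pmf P y) (pmf Q y)"
  have "r\<^sup>2 \<le> (\<Sum>y\<in>\<Omega>. sqrt (pmf P y * pmf Q y))\<^sup>2"
    using r by (rule power_mono[rotated])
  also have "\<dots> = (\<Sum>y\<in>\<Omega>. sqrt (?m y) * sqrt (?M y))\<^sup>2"
    by (intro arg_cong[where f = "\<lambda>x. x\<^sup>2"] sum.cong)
       (auto simp: min_def max_def mult.commute simp flip: real_sqrt_mult)
  also have "\<dots> \<le> (\<Sum>y\<in>\<Omega>. (sqrt (?m y))\<^sup>2) * (\<Sum>y\<in>\<Omega>. (sqrt (?M y))\<^sup>2)"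
    by (rule Cauchy_Schwarz_ineq_sum)
  also have "\<dots> = (\<Sum>y\<in>\<Omega>. ?m y) * (\<Sum>y\<in>\<Omega>. ?M y)"
    by (simp add: le_max_iff_disj)
  also have "\<dots> \<le> (\<Sum>y\<in>\<Omega>. ?m y) * (\<Sum>y\<in>\<Omega>. pmf P y + pmf Q y)"
    by (intro mult_left_mono sum_mono sum_nonneg) auto
  also have "(\<Sum>y\<in>\<Omega>. pmf P y + pmf Q y) = 2"
    using sum_pmf_eq_1[OF fin P] sum_pmf_eq_1[OF fin Q] by (simp add: sum.distrib)
  finally show ?thesis by simp
qed

text \<open>For fixed \<open>i\<close> the cube splits into pairs \<open>S\<close>,
  \<open>insert i S\<close>. On each pair the decoder \<open>g\<close> errs at \<open>i\<close> with
  total probability at least the overlap of the two laws, hence at least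
  \<open>r\<^sup>2 / 2\<close>. There are \<open>2 ^ (card A - 1)\<close> pairs, and the errors add
  up over \<open>i\<close>.\<close>

lemma assouad:
  fixes P :: "nat set \<Rightarrow> 'a pmf" and g :: "'a \<Rightarrow> nat set"
  assumes A: "finite A" and fin: "finite \<Omega>"
    and P: "\<And>S. S \<subseteq> A \<Longrightarrow> set_pmf (P S) \<subseteq> \<Omega>"
    and r: "0 \<le> r"
    and aff: "\<And>S i. S \<subseteq> A \<Longrightarrow> i \<in> A \<Longrightarrow> i \<notin> S \<Longrightarrow>
               r \<le> (\<Sum>y\<in>\<Omega>. sqrt (pmf (P S) y * pmf (P (insert i S)) y))"
  shows "2 ^ card A * real (card A) * r\<^sup>2 / 4
           \<le> (\<Sum>S\<in>Pow A. \<Sum>y\<in>\<Omega>. pmf (P S) y * real (card {i \<in> A. (i \<in> g y) \<noteq> (i \<in> S)}))"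
proof -
  define E where "E i S = (\<Sum>y\<in>\<Omega>. pmf (P S) y * of_bool ((i \<in> g y) \<noteq> (i \<in> S)))" for i S
  have one: "2 ^ card A * r\<^sup>2 / 4 \<le> (\<Sum>S\<in>Pow A. E i S)" if i: "i \<in> A" for i
  proof -
    have A': "A = insert i (A - {i})" using i by auto
    have "2 ^ card A * r\<^sup>2 / 4 = (\<Sum>S\<in>Pow (A - {i}). r\<^sup>2 / 2)"
      using card_Suc_Diff1[OF A i] A
      by (simp add: card_Pow) (metis power_Suc2)
    also have "\<dots> \<le> (\<Sum>S\<in>Pow (A - {i}). E i S + E i (insert i S))"
    proof (rule sum_mono)
      fix S assume "S \<in> Pow (A - {i})"
      then have S: "S \<subseteq> A" "insert i S \<subseteq> A" "i \<notin> S" using i by auto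
      have "r\<^sup>2 / 2 \<le> (\<Sum>y\<in>\<Omega>. min (pmf (P S) y) (pmf (P (insert i S)) y))"
        by (rule sum_min_pmf_ge[OF fin P[OF S(1)] P[OF S(2)] r aff[OF S(1) i S(3)]])
      \<comment> \<open>Each \<open>y\<close> is decoded wrongly at \<open>i\<close> for exactly one
        of the two sets, and so contributes at least the smaller of its two masses.\<close>
      also have "\<dots> \<le> E i S + E i (insert i S)"
        unfolding E_def sum.distrib[symmetric] by (rule sum_mono) (use S in auto)
      finally show "r\<^sup>2 / 2 \<le> E i S + E i (insert i S)" .
    qed
    also have "\<dots> = (\<Sum>S\<in>Pow (A - {i}). E i S) + (\<Sum>S\<in>insert i ` Pow (A - {i}). E i S)"
      by (subst sum.reindex) (auto simp: sum.distrib intro!: inj_onI)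
    also have "\<dots> = (\<Sum>S\<in>Pow (A - {i}) \<union> insert i ` Pow (A - {i}). E i S)"
      by (rule sum.union_disjoint[symmetric]) (use A in auto)
    also have "Pow (A - {i}) \<union> insert i ` Pow (A - {i}) = Pow A"
      using A' Pow_insert by metis
    finally show ?thesis .
  qed
  have "2 ^ card A * real (card A) * r\<^sup>2 / 4 = (\<Sum>i\<in>A. 2 ^ card A * r\<^sup>2 / 4)" by simp
  also have "\<dots> \<le> (\<Sum>i\<in>A. \<Sum>S\<in>Pow A. E i S)" by (rule sum_mono[OF one])
  also have "\<dots> = (\<Sum>S\<in>Pow A. \<Sum>i\<in>A. E i S)" by (rule sum.swap)
  also have "\<dots> = (\<Sum>S\<in>Pow A. \<Sum>y\<in>\<Omega>. pmf (P S) y * real (card {i \<in> A. (i \<in> g y) \<noteq> (i \<in> S)}))"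
  proof (rule sum.cong[OF refl])
    fix S
    have "(\<Sum>i\<in>A. E i S) = (\<Sum>y\<in>\<Omega>. \<Sum>i\<in>A. pmf (P S) y * of_bool ((i \<in> g y) \<noteq> (i \<in> S)))"
      unfolding E_def by (rule sum.swap)
    also have "\<dots> = (\<Sum>y\<in>\<Omega>. pmf (P S) y * real (card {i \<in> A. (i \<in> g y) \<noteq> (i \<in> S)}))"
      using A by (simp add: Int_def flip: sum_distrib_left)
    finally show "(\<Sum>i\<in>A. E i S) = \<dots>" .
  qed
  finally show ?thesis .
qed

text \<open>Reverse Markov argument: the Hamming error never exceeds \<open>card A\<close>, so it is
  at most \<open>t * card A\<close> plus \<open>card A\<close> times the indicator that this level
  is reached.\<close>

lemma assouad_prob:
  fixes P :: "nat set \<Rightarrow> 'a pmf" and g :: "'a \<Rightarrow> nat set"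
  assumes A: "finite A" "A \<noteq> {}" and fin: "finite \<Omega>"
    and P: "\<And>S. S \<subseteq> A \<Longrightarrow> set_pmf (P S) \<subseteq> \<Omega>"
    and r: "0 \<le> r"
    and aff: "\<And>S i. S \<subseteq> A \<Longrightarrow> i \<in> A \<Longrightarrow> i \<notin> S \<Longrightarrow>
               r \<le> (\<Sum>y\<in>\<Omega>. sqrt (pmf (P S) y * pmf (P (insert i S)) y))"
    and t: "0 \<le> t"
  shows "2 ^ card A * (r\<^sup>2 / 4 - t)
           \<le> (\<Sum>S\<in>Pow A. measure_pmf.prob (P S)
                {y. t * real (card A) \<le> real (card {i \<in> A. (i \<in> g y) \<noteq> (i \<in> S)})})"
proof -
  define H where "H y S = real (card {i \<in> A. (i \<in> g y) \<noteq> (i \<in> S)})" for y S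
  define n where "n = real (card A)"
  have n: "n > 0" using A by (simp add: n_def card_gt_0_iff)
  have Hn: "H y S \<le> n" for y S
    using A by (auto simp: H_def n_def intro: card_mono)
  have "2 ^ card A * n * r\<^sup>2 / 4 \<le> (\<Sum>S\<in>Pow A. \<Sum>y\<in>\<Omega>. pmf (P S) y * H y S)"
    unfolding H_def n_def using A(1) fin P r aff by (rule assouad)
  also have "\<dots> \<le> (\<Sum>S\<in>Pow A. n * t + n * measure_pmf.prob (P S) {y. t * n \<le> H y S})"
  proof (rule sum_mono)
    fix S assume "S \<in> Pow A"
    then have S: "set_pmf (P S) \<subseteq> \<Omega>" using P by simp
    have "(\<Sum>y\<in>\<Omega>. pmf (P S) y * H y S)
        \<le> (\<Sum>y\<in>\<Omega>. pmf (P S) y * (n * t + n * indicator {y. t * n \<le> H y S} y))"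
      using Hn n t
      by (intro sum_mono mult_left_mono)
         (auto simp: indicator_def mult.commute intro: add_increasing less_imp_le)
    also have "\<dots> = (\<Sum>y\<in>\<Omega>. pmf (P S) y) * (n * t) + n * (\<Sum>y\<in>\<Omega>. pmf (P S) y * indicator {y. t * n \<le> H y S} y)"
      by (simp add: distrib_left sum.distrib sum_distrib_left sum_distrib_right mult_ac)
    also have "(\<Sum>y\<in>\<Omega>. pmf (P S) y * indicator {y. t * n \<le> H y S} y)
        = measure_pmf.expectation (P S) (indicator {y. t * n \<le> H y S})"
      using fin S by (subst integral_measure_pmf_real[of \<Omega>]) (auto simp: mult.commute)
    also have "\<dots> = measure_pmf.prob (P S) {y. t * n \<le> H y S}" by simp
    finally show "(\<Sum>y\<in>\<Omega>. pmf (P S) y * H y S)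
        \<le> n * t + n * measure_pmf.prob (P S) {y. t * n \<le> H y S}"
      using sum_pmf_eq_1[OF fin S] by simp
  qed
  also have "\<dots> = n * (2 ^ card A * t + (\<Sum>S\<in>Pow A. measure_pmf.prob (P S) {y. t * n \<le> H y S}))"
    using A by (simp add: sum.distrib card_Pow sum_distrib_left algebra_simps)
  finally have "n * (2 ^ card A * (r\<^sup>2 / 4))
      \<le> n * (2 ^ card A * t + (\<Sum>S\<in>Pow A. measure_pmf.prob (P S) {y. t * n \<le> H y S}))"
    by (simp add: mult_ac)
  then show ?thesis
    using n by (simp add: H_def n_def right_diff_distrib mult.commute)
qed

section \<open>Hellinger affinity of product laws\<close>

text \<open>Restriction to \<open>A\<close> identifies the functions with a default value with
  \<open>PiE A B\<close>, where the distributive law \<open>prod_sum_PiE\<close> applies.\<close>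

lemma sum_PiE_dflt_prod:
  fixes f :: "'a \<Rightarrow> 'b \<Rightarrow> 'c :: comm_semiring_1"
  assumes A: "finite A" and B: "\<And>x. x \<in> A \<Longrightarrow> finite (B x)"
  shows "(\<Sum>g\<in>PiE_dflt A d B. \<Prod>x\<in>A. f x (g x)) = (\<Prod>x\<in>A. \<Sum>b\<in>B x. f x b)"
proof -
  have inj: "inj_on (\<lambda>h. restrict h A) (PiE_dflt A d B)"
  proof (rule inj_onI)
    fix g h assume *: "g \<in> PiE_dflt A d B" "h \<in> PiE_dflt A d B" "restrict g A = restrict h A"
    show "g = h"
    proof
      fix x
      show "g x = h x"
        using * by (cases "x \<in> A") (auto simp: PiE_dflt_def dest: fun_cong[where x = x])
    qed
  qed
  have "(\<Prod>x\<in>A. \<Sum>b\<in>B x. f x b) = (\<Sum>g\<in>PiE A B. \<Prod>x\<in>A. f x (g x))"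
    using A B by (rule prod_sum_PiE)
  also have "\<dots> = (\<Sum>g\<in>PiE_dflt A d B. \<Prod>x\<in>A. f x (restrict g A x))"
    by (subst restrict_PiE_dflt[symmetric, where dflt = d]) (simp add: sum.reindex[OF inj])
  finally show ?thesis by simp
qed

lemma sqrt_prod: "sqrt (prod f A) = (\<Prod>x\<in>A. sqrt (f x))"
  by (induction A rule: infinite_finite_induct) (auto simp: real_sqrt_mult)

lemma affinity_Pi_pmf:
  fixes p q :: "'a \<Rightarrow> 'b :: finite pmf"
  assumes A: "finite A"
  shows "(\<Sum>y\<in>PiE_dflt A d (\<lambda>_. UNIV). sqrt (pmf (Pi_pmf A d p) y * pmf (Pi_pmf A d q) y))
       = (\<Prod>x\<in>A. \<Sum>b\<in>UNIV. sqrt (pmf (p x) b * pmf (q x) b))"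
proof -
  have "sqrt (pmf (Pi_pmf A d p) y * pmf (Pi_pmf A d q) y)
      = (\<Prod>x\<in>A. sqrt (pmf (p x) (y x) * pmf (q x) (y x)))"
    if "y \<in> PiE_dflt A d (\<lambda>_. UNIV)" for y
  proof -
    have "pmf (Pi_pmf A d r) y = (\<Prod>x\<in>A. pmf (r x) (y x))" for r
      by (rule pmf_Pi'[OF A]) (use that in \<open>auto simp: PiE_dflt_def\<close>)
    then show ?thesis by (simp add: real_sqrt_mult sqrt_prod prod.distrib)
  qed
  then show ?thesis
    using sum_PiE_dflt_prod[OF A, of "\<lambda>_. UNIV" "\<lambda>x b. sqrt (pmf (p x) b * pmf (q x) b)" d] by simp
qed

subsection \<open>Orthonormal bases for a positive definite form\<close>

lemma orthogonal_vec_exists: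
  fixes c :: "nat \<Rightarrow> real vec"
  assumes k: "k < n" and c: "\<And>i. i < k \<Longrightarrow> c i \<in> carrier_vec n"
  obtains x where "x \<in> carrier_vec n" "x \<noteq> 0\<^sub>v n" "\<And>i. i < k \<Longrightarrow> c i \<bullet> x = 0"
proof -
  \<comment> \<open>The \<open>c i\<close> with \<open>i \<ge> k\<close> are not known to have
    dimension \<open>n\<close> and are replaced by zero; row \<open>k\<close> is the explicit zero
    row in the form of \<open>det_row_0\<close>.\<close>
  define c' where "c' i = (if i < k then c i else 0\<^sub>v n)" for i
  define A where "A = mat\<^sub>r n n (\<lambda>i. if i = k then 0\<^sub>v n else c' i)"
  have "det A = 0"
    unfolding A_def by (rule det_row_0[OF k]) (use c in \<open>auto simp: c'_def\<close>)
  moreover have A: "A \<in> carrier_mat n n" by (simp add: A_def)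
  ultimately obtain x where x: "x \<in> carrier_vec n" "x \<noteq> 0\<^sub>v n" "A *\<^sub>v x = 0\<^sub>v n"
    using det_0_iff_vec_prod_zero by blast
  have "c i \<bullet> x = 0" if i: "i < k" for i
  proof -
    have "row A i = c i"
      using i k c[OF i] by (simp add: A_def c'_def)
    then show ?thesis
      using arg_cong[OF x(3), of "\<lambda>v. v $ i"] i k A by simp
  qed
  with x that show thesis by blast
qed

text \<open>Gram-Schmidt for the inner product given by \<open>W\<close>: the next vector is
  Euclidean-orthogonal to all \<open>W *\<^sub>v b i\<close> and is then normalised in the
  form.\<close>

lemma pos_def_orthonormal_vecs:
  assumes W: "pos_def_mat n W" and k: "k \<le> n"
  shows "\<exists>b :: nat \<Rightarrow> real vec. (\<forall>i<k. b i \<in> carrier_vec n) \<and>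
           (\<forall>i<k. \<forall>j<k. b i \<bullet> (W *\<^sub>v b j) = (if i = j then 1 else 0))"
  using k
proof (induction k)
  case 0
  show ?case by simp
next
  case (Suc k)
  have Wc: "W \<in> carrier_mat n n" and Ws: "W\<^sup>T = W"
    using W by (auto simp: pos_def_mat_def)
  from Suc obtain b where b: "\<And>i. i < k \<Longrightarrow> b i \<in> carrier_vec n"
      "\<And>i j. i < k \<Longrightarrow> j < k \<Longrightarrow> b i \<bullet> (W *\<^sub>v b j) = (if i = j then 1 else 0)"
    by (metis Suc_leD)
  obtain x where x: "x \<in> carrier_vec n" "x \<noteq> 0\<^sub>v n" "\<And>i. i < k \<Longrightarrow> (W *\<^sub>v b i) \<bullet> x = 0"
    using orthogonal_vec_exists[of k n "\<lambda>i. W *\<^sub>v b i"] Suc.prems b(1) Wc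
    by (metis Suc_le_eq mult_mat_vec_carrier)
  define e where "e = x \<bullet> (W *\<^sub>v x)"
  have e: "e > 0" using W x by (simp add: e_def pos_def_mat_def)
  define u where "u = (1 / sqrt e) \<cdot>\<^sub>v x"
  have u: "u \<in> carrier_vec n" using x by (simp add: u_def)
  have Wu: "W *\<^sub>v u = (1 / sqrt e) \<cdot>\<^sub>v (W *\<^sub>v x)"
    using Wc x by (simp add: u_def mult_mat_vec)
  have uu: "u \<bullet> (W *\<^sub>v u) = 1"
    using Wc x e by (simp add: Wu) (simp add: u_def e_def[symmetric] field_simps)
  have ub: "u \<bullet> (W *\<^sub>v b i) = 0" "b i \<bullet> (W *\<^sub>v u) = 0" if i: "i < k" for i
  proof -
    have c: "W *\<^sub>v b i \<in> carrier_vec n" using Wc b(1)[OF i] by simp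
    have "u \<bullet> (W *\<^sub>v b i) = (1 / sqrt e) * (x \<bullet> (W *\<^sub>v b i))"
      using x c by (simp add: u_def)
    also have "x \<bullet> (W *\<^sub>v b i) = 0"
      using x(3)[OF i] comm_scalar_prod[OF x(1) c] by simp
    finally show 1: "u \<bullet> (W *\<^sub>v b i) = 0" by simp
    have "b i \<bullet> (W *\<^sub>v u) = (W *\<^sub>v b i) \<bullet> u"
      using transpose_vec_mult_scalar[OF Wc u b(1)[OF i]] by (simp add: Ws)
    then show "b i \<bullet> (W *\<^sub>v u) = 0"
      using 1 comm_scalar_prod[OF u c] by simp
  qed
  show ?case
    by (rule exI[of _ "b(k := u)"]) (auto simp: less_Suc_eq b u uu ub)
qed

lemma pos_def_orthonormal_mat:
  assumes W: "pos_def_mat n W"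
  obtains T where "T \<in> carrier_mat n n" "T\<^sup>T * (W * T) = 1\<^sub>m n"
proof -
  have Wc: "W \<in> carrier_mat n n" using W by (simp add: pos_def_mat_def)
  obtain b where b: "\<And>i. i < n \<Longrightarrow> b i \<in> carrier_vec n"
      "\<And>i j. i < n \<Longrightarrow> j < n \<Longrightarrow> b i \<bullet> (W *\<^sub>v b j) = (if i = j then 1 else 0)"
    using pos_def_orthonormal_vecs[OF W order_refl] by blast
  define T where "T = mat_of_cols n (map b [0..<n])"
  have T: "T \<in> carrier_mat n n" by (auto simp: T_def)
  have col: "col T i = b i" if "i < n" for i
    using that b(1) by (simp add: T_def)
  have "T\<^sup>T * (W * T) = 1\<^sub>m n"
  proof (rule eq_matI)
    fix i j assume "i < dim_row (1\<^sub>m n :: real mat)" "j < dim_col (1\<^sub>m n :: real mat)"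
    then have ij: "i < n" "j < n" by simp_all
    then show "(T\<^sup>T * (W * T)) $$ (i, j) = 1\<^sub>m n $$ (i, j)"
      using T Wc b(2)[OF ij] by (simp add: col_mult2[OF Wc T] col mult_mat_vec_def)
  qed (use T Wc in auto)
  with T that show thesis by blast
qed

section \<open>The inverse of a positive definite matrix from an orthonormal basis\<close>

text \<open>Connects the computed \<open>mat_inverse\<close>, which enters \<open>coherence\<close>,
  with the algebraic inverse: a left inverse excludes \<open>None\<close> and determines the
  result.\<close>

lemma mat_inverse_eqI:
  fixes A :: "'a :: field mat"
  assumes A: "A \<in> carrier_mat n n" and C: "C \<in> carrier_mat n n" and CA: "C * A = 1\<^sub>m n"
  shows "mat_inverse A = Some C"
proof (cases "mat_inverse A")
  case None
  have "A * C = 1\<^sub>m n" by (rule mat_mult_left_right_inverse[OF C A CA])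
  then have "A \<in> Units (ring_mat TYPE('a) n ())"
    using A C CA by (auto simp: Units_def ring_mat_simps)
  with mat_inverse(1)[OF A None, of "()"] show ?thesis by blast
next
  case (Some D)
  from mat_inverse(2)[OF A Some] have D: "A * D = 1\<^sub>m n" "D \<in> carrier_mat n n" by auto
  have "C = C * (A * D)" using C D by simp
  also have "\<dots> = (C * A) * D" using C A D by (simp add: assoc_mult_mat)
  also have "\<dots> = D" using D by (simp add: CA)
  finally show ?thesis using Some by simp
qed

lemma orthonormal_mat_inverse:
  assumes W: "W \<in> carrier_mat n n" and T: "T \<in> carrier_mat n n" and TWT: "T\<^sup>T * (W * T) = 1\<^sub>m n"
  shows "mat_inverse W = Some (T * T\<^sup>T)"
proof (rule mat_inverse_eqI)
  have T': "T\<^sup>T \<in> carrier_mat n n" using T by simp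
  have "(T\<^sup>T * W) * T = 1\<^sub>m n"
    unfolding assoc_mult_mat[OF T' W T] by (rule TWT)
  \<comment> \<open>A one-sided inverse of a square matrix is two-sided, which moves
    \<open>T\<close> from the right end to the left.\<close>
  then have "T * (T\<^sup>T * W) = 1\<^sub>m n"
    by (rule mat_mult_left_right_inverse[OF mult_carrier_mat[OF T' W] T])
  then show "T * T\<^sup>T * W = 1\<^sub>m n"
    unfolding assoc_mult_mat[OF T T' W] .
qed (use W T in auto)

subsection \<open>The excess risk\<close>

lemma finite_queries: "btl_setting M \<Longrightarrow> finite (queries M)"
  by (rule finite_subset[of _ "{..<n_items M} \<times> {..<n_items M}"])
     (auto simp: btl_setting_def)

text \<open>The queries and their reversals are disjoint and both lie in the square grid of all
  pairs of items.\<close>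

lemma card_queries_le:
  assumes "btl_setting M"
  shows "2 * card (queries M) \<le> (n_items M)\<^sup>2"
proof -
  let ?d = "n_items M" and ?Q = "queries M"
  have Q: "finite ?Q" "finite (prod.swap ` ?Q)" using finite_queries[OF assms] by simp_all
  have "?Q \<subseteq> {(i, j). i < j \<and> j < ?d}" using assms by (simp add: btl_setting_def)
  then have sub: "?Q \<union> prod.swap ` ?Q \<subseteq> {..<?d} \<times> {..<?d}" and lt: "\<And>i j. (i, j) \<in> ?Q \<Longrightarrow> i < j"
    by auto
  have disj: "?Q \<inter> prod.swap ` ?Q = {}" by (auto dest!: lt)
  have "2 * card ?Q = card ?Q + card (prod.swap ` ?Q)" by (simp add: card_image)
  also have "\<dots> = card (?Q \<union> prod.swap ` ?Q)" using Q disj by (simp add: card_Un_disjoint)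
  also have "\<dots> \<le> card ({..<?d} \<times> {..<?d})" by (rule card_mono[OF _ sub]) simp
  finally show ?thesis by (simp add: power2_eq_square)
qed

lemma finite_resp_index: "btl_setting M \<Longrightarrow> finite (resp_index M)"
  by (simp add: resp_index_def finite_queries)

lemma finite_resp_space: "btl_setting M \<Longrightarrow> finite (resp_space M)"
  unfolding resp_space_def by (intro finite_PiE_dflt finite_resp_index) auto

lemma resp_pmf_altdef:
  "resp_pmf M \<theta> = Pi_pmf (resp_index M) False (\<lambda>x. bernoulli_pmf (logistic (eta M (fst x) \<theta>)))"
  by (simp add: resp_pmf_def logistic_def case_prod_unfold)

lemma set_resp_pmf: "btl_setting M \<Longrightarrow> set_pmf (resp_pmf M \<theta>) \<subseteq> resp_space M"
  unfolding resp_pmf_def resp_space_def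
  using set_Pi_pmf_subset'[OF finite_resp_index] by (fastforce simp: PiE_dflt_def)

lemma integrable_resp_pmf:
  fixes f :: "response \<Rightarrow> real"
  shows "btl_setting M \<Longrightarrow> integrable (measure_pmf (resp_pmf M \<theta>)) f"
  by (rule integrable_measure_pmf_finite) (rule finite_subset[OF set_resp_pmf finite_resp_space])

lemma n_obs_pos:
  assumes "btl_setting M"
  shows "0 < n_obs M"
proof -
  obtain \<alpha> where "\<alpha> \<in> queries M" "0 < reps M \<alpha>"
    using assms by (fastforce simp: btl_setting_def)
  then show ?thesis
    using finite_queries[OF assms] by (auto simp: n_obs_def sum_pos2)
qed

section \<open>The population loss as an average of divergences\<close>

lemma expectation_successes:
  assumes M: "btl_setting M" and \<alpha>: "\<alpha> \<in> queries M"
  shows "measure_pmf.expectation (resp_pmf M \<theta>) (\<lambda>y. successes M y \<alpha>)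
           = real (reps M \<alpha>) * logistic (eta M \<alpha> \<theta>)"
proof -
  have "measure_pmf.expectation (resp_pmf M \<theta>) (\<lambda>y. of_bool (y (\<alpha>, t))) = logistic (eta M \<alpha> \<theta>)"
    if t: "t \<in> {1..reps M \<alpha>}" for t
  proof -
    have "measure_pmf.expectation (resp_pmf M \<theta>) (\<lambda>y. of_bool (y (\<alpha>, t)) :: real)
        = measure_pmf.expectation (map_pmf (\<lambda>y. y (\<alpha>, t)) (resp_pmf M \<theta>)) of_bool"
      by simp
    also have "map_pmf (\<lambda>y. y (\<alpha>, t)) (resp_pmf M \<theta>) = bernoulli_pmf (logistic (eta M \<alpha> \<theta>))"
    proof -
      have "(\<alpha>, t) \<in> resp_index M" using \<alpha> t by (simp add: resp_index_def)
      then show ?thesis by (simp add: resp_pmf_altdef Pi_pmf_component finite_resp_index[OF M])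
    qed
    also have "measure_pmf.expectation \<dots> of_bool = logistic (eta M \<alpha> \<theta>)"
      using logistic_pos logistic_less_1 by (simp add: less_imp_le)
    finally show ?thesis .
  qed
  then have "(\<Sum>t = 1..reps M \<alpha>. measure_pmf.expectation (resp_pmf M \<theta>) (\<lambda>y. of_bool (y (\<alpha>, t))))
      = real (reps M \<alpha>) * logistic (eta M \<alpha> \<theta>)" by simp
  then show ?thesis
    unfolding successes_def
    by (subst Bochner_Integration.integral_sum) (rule integrable_resp_pmf[OF M])
qed

lemma pop_loss_eq:
  assumes M: "btl_setting M"
  shows "pop_loss M \<theta> v = (1 / real (n_obs M)) *
    (\<Sum>\<alpha>\<in>queries M. real (reps M \<alpha>) * (Psi (eta M \<alpha> v) - logistic (eta M \<alpha> \<theta>) * eta M \<alpha> v))"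
proof -
  have "pop_loss M \<theta> v = (1 / real (n_obs M)) *
      (\<Sum>\<alpha>\<in>queries M. measure_pmf.expectation (resp_pmf M \<theta>)
         (\<lambda>y. - successes M y \<alpha> * eta M \<alpha> v + real (reps M \<alpha>) * Psi (eta M \<alpha> v)))"
    unfolding pop_loss_def nll_def
    by (simp add: Bochner_Integration.integral_sum integrable_resp_pmf[OF M]
          del: Bochner_Integration.integral_add Bochner_Integration.integral_diff)
  also have "(\<Sum>\<alpha>\<in>queries M. measure_pmf.expectation (resp_pmf M \<theta>)
         (\<lambda>y. - successes M y \<alpha> * eta M \<alpha> v + real (reps M \<alpha>) * Psi (eta M \<alpha> v)))
     = (\<Sum>\<alpha>\<in>queries M. real (reps M \<alpha>) * (Psi (eta M \<alpha> v) - logistic (eta M \<alpha> \<theta>) * eta M \<alpha> v))"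
    by (rule sum.cong[OF refl])
       (simp add: integrable_resp_pmf[OF M] expectation_successes[OF M] algebra_simps)
  finally show ?thesis .
qed

text \<open>The mean response is the derivative of \<open>Psi\<close> at the true log-odds, so the
  linear terms of the loss form the tangent in \<open>bregman_Psi\<close>.\<close>

lemma excess_eq:
  assumes M: "btl_setting M"
  shows "excess M v \<theta> = (1 / real (n_obs M)) *
    (\<Sum>\<alpha>\<in>queries M. real (reps M \<alpha>) * bregman_Psi (eta M \<alpha> v) (eta M \<alpha> \<theta>))"
  unfolding excess_def pop_loss_eq[OF M] right_diff_distrib[symmetric] sum_subtractf[symmetric]
  by (simp add: bregman_Psi_def algebra_simps)

lemma excess_nonneg: "btl_setting M \<Longrightarrow> 0 \<le> excess M v \<theta>"
  by (simp add: excess_eq bregman_Psi_nonneg sum_nonneg)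

text \<open>On the parameter space this is the quadratic form of \<open>design_mat M\<close> at
  \<open>\<theta> - \<theta>'\<close>, divided by \<open>(scale M)\<^sup>2\<close>.\<close>

definition pred_dist :: "btl \<Rightarrow> real vec \<Rightarrow> real vec \<Rightarrow> real" where
  "pred_dist M \<theta> \<theta>' = (1 / real (n_obs M)) *
     (\<Sum>\<alpha>\<in>queries M. real (reps M \<alpha>) * (eta M \<alpha> \<theta> - eta M \<alpha> \<theta>')\<^sup>2)"

text \<open>Takes the place of a triangle inequality: a single \<open>v\<close> cannot have small
  excess risk at two parameters with distant predictions.\<close>

lemma excess_pair:
  assumes M: "btl_setting M" and B: "1 < B" and th: "\<theta> \<in> par_set M B" "\<theta>' \<in> par_set M B"
  shows "pred_dist M \<theta> \<theta>' / (16 * B) \<le> excess M v \<theta> + excess M v \<theta>'"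
proof -
  have "pred_dist M \<theta> \<theta>' / (16 * B) = (1 / real (n_obs M)) *
      (\<Sum>\<alpha>\<in>queries M. real (reps M \<alpha>) * ((eta M \<alpha> \<theta> - eta M \<alpha> \<theta>')\<^sup>2 / (16 * B)))"
    by (simp add: pred_dist_def sum_divide_distrib mult_ac)
  also have "\<dots> \<le> (1 / real (n_obs M)) * (\<Sum>\<alpha>\<in>queries M. real (reps M \<alpha>) *
      (bregman_Psi (eta M \<alpha> v) (eta M \<alpha> \<theta>) + bregman_Psi (eta M \<alpha> v) (eta M \<alpha> \<theta>')))"
    by (intro mult_left_mono sum_mono bregman_Psi_pair[OF B]) (use th in \<open>auto simp: par_set_def\<close>)
  also have "\<dots> = excess M v \<theta> + excess M v \<theta>'"
    by (simp add: excess_eq[OF M] distrib_left sum.distrib)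
  finally show ?thesis .
qed

text \<open>\<open>n_obs M\<close> times \<open>pred_dist\<close> is a sum over single responses;
  the affinity is a product over them, with factors bounded by
  \<open>bernoulli_affinity\<close>.\<close>

lemma resp_affinity:
  assumes M: "btl_setting M"
  shows "exp (- (real (n_obs M) * pred_dist M \<theta> \<theta>' / 32))
    \<le> (\<Sum>y\<in>resp_space M. sqrt (pmf (resp_pmf M \<theta>) y * pmf (resp_pmf M \<theta>') y))"
proof -
  let ?D = "\<lambda>\<alpha>. (eta M \<alpha> \<theta> - eta M \<alpha> \<theta>')\<^sup>2"
  have "real (n_obs M) * pred_dist M \<theta> \<theta>' = (\<Sum>\<alpha>\<in>queries M. \<Sum>t\<in>{1..reps M \<alpha>}. ?D \<alpha>)"
    using n_obs_pos[OF M] by (simp add: pred_dist_def)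
  also have "\<dots> = (\<Sum>x\<in>resp_index M. ?D (fst x))"
    by (subst sum.Sigma) (auto simp: finite_queries[OF M] resp_index_def case_prod_unfold)
  finally have "exp (- (real (n_obs M) * pred_dist M \<theta> \<theta>' / 32))
      = (\<Prod>x\<in>resp_index M. exp (- (?D (fst x) / 32)))"
    by (simp add: finite_resp_index[OF M] sum_divide_distrib flip: sum_negf exp_sum)
  also have "\<dots> \<le> (\<Prod>x\<in>resp_index M. \<Sum>b\<in>UNIV.
      sqrt (pmf (bernoulli_pmf (logistic (eta M (fst x) \<theta>))) b *
            pmf (bernoulli_pmf (logistic (eta M (fst x) \<theta>'))) b))"
    using bernoulli_affinity logistic_pos logistic_less_1
    by (intro prod_mono) (simp add: UNIV_bool less_imp_le add.commute)
  also have "\<dots> = (\<Sum>y\<in>resp_space M. sqrt (pmf (resp_pmf M \<theta>) y * pmf (resp_pmf M \<theta>') y))"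
    unfolding resp_pmf_altdef resp_space_def
    by (rule affinity_Pi_pmf[symmetric, OF finite_resp_index[OF M]])
  finally show ?thesis .
qed

subsection \<open>The hypercube of parameters\<close>

lemma contrast_carrier: "contrast M \<alpha> \<in> carrier_vec (n_feat M)"
proof -
  have "feat_mat M \<in> carrier_mat (n_items M) (n_feat M)"
    unfolding feat_mat_def by (rule carrier_matI) simp_all
  then show ?thesis
    unfolding contrast_def by (intro mult_mat_vec_carrier[of _ _ "n_items M"]) auto
qed

lemma qvec_carrier: "btl_setting M \<Longrightarrow> qvec M \<alpha> \<in> carrier_vec (par_dim M)"
  unfolding qvec_def by (rule mult_mat_vec_carrier[OF _ contrast_carrier]) (simp add: btl_setting_def)

lemma design_mat_carrier: "design_mat M \<in> carrier_mat (par_dim M) (par_dim M)"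
  by (simp add: design_mat_def)

lemma design_mat_quadratic_form:
  assumes M: "btl_setting M" and v: "v \<in> carrier_vec (par_dim M)"
  shows "v \<bullet> (design_mat M *\<^sub>v v)
    = (1 / real (n_obs M)) * (\<Sum>\<alpha>\<in>queries M. real (reps M \<alpha>) * (qvec M \<alpha> \<bullet> v)\<^sup>2)"
proof -
  let ?I = "{0..<par_dim M}" and ?q = "qvec M" and ?N = "real (n_obs M)"
  have "v \<bullet> (design_mat M *\<^sub>v v) = (\<Sum>r\<in>?I. \<Sum>s\<in>?I. v $ r * (1 / ?N *
      (\<Sum>\<alpha>\<in>queries M. real (reps M \<alpha>) * (?q \<alpha> $ r * ?q \<alpha> $ s)) * v $ s))"
    using v by (simp add: scalar_prod_def design_mat_def sum_distrib_left row_def)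
  also have "\<dots> = (\<Sum>r\<in>?I. \<Sum>s\<in>?I. \<Sum>\<alpha>\<in>queries M.
      1 / ?N * real (reps M \<alpha>) * ((?q \<alpha> $ r * v $ r) * (?q \<alpha> $ s * v $ s)))"
    by (simp add: sum_distrib_left sum_distrib_right mult_ac)
  also have "\<dots> = (\<Sum>r\<in>?I. \<Sum>\<alpha>\<in>queries M. \<Sum>s\<in>?I.
      1 / ?N * real (reps M \<alpha>) * ((?q \<alpha> $ r * v $ r) * (?q \<alpha> $ s * v $ s)))"
    by (intro sum.cong[OF refl] sum.swap)
  also have "\<dots> = (\<Sum>\<alpha>\<in>queries M. \<Sum>r\<in>?I. \<Sum>s\<in>?I.
      1 / ?N * real (reps M \<alpha>) * ((?q \<alpha> $ r * v $ r) * (?q \<alpha> $ s * v $ s)))"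
    by (rule sum.swap)
  also have "\<dots> = (1 / ?N) * (\<Sum>\<alpha>\<in>queries M. real (reps M \<alpha>) * (?q \<alpha> \<bullet> v)\<^sup>2)"
  proof -
    have "(?q \<alpha> \<bullet> v)\<^sup>2 = (\<Sum>r\<in>?I. \<Sum>s\<in>?I. (?q \<alpha> $ r * v $ r) * (?q \<alpha> $ s * v $ s))" for \<alpha>
      using v by (simp add: scalar_prod_def power2_eq_square sum_product)
    then show ?thesis by (simp add: sum_distrib_left mult.assoc)
  qed
  finally show ?thesis .
qed

text \<open>The factor \<open>scale M\<close> cancels the division in \<open>eta\<close>, so
  \<open>\<delta>\<close> is measured in log-odds.\<close>

definition cube_point :: "btl \<Rightarrow> real mat \<Rightarrow> real \<Rightarrow> nat set \<Rightarrow> real vec" where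
  "cube_point M T \<delta> S = (scale M * \<delta>) \<cdot>\<^sub>v (T *\<^sub>v vec (par_dim M) (rademacher S))"

lemma cube_point_carrier:
  "T \<in> carrier_mat (par_dim M) (par_dim M) \<Longrightarrow> cube_point M T \<delta> S \<in> carrier_vec (par_dim M)"
  by (simp add: cube_point_def)

lemma qvec_mult_mat:
  assumes M: "btl_setting M" and T: "T \<in> carrier_mat (par_dim M) (par_dim M)"
    and v: "v \<in> carrier_vec (par_dim M)"
  shows "qvec M \<alpha> \<bullet> (T *\<^sub>v v) = (\<Sum>i<par_dim M. v $ i * (T\<^sup>T *\<^sub>v qvec M \<alpha>) $ i)"
proof -
  have "qvec M \<alpha> \<bullet> (T *\<^sub>v v) = (T\<^sup>T *\<^sub>v qvec M \<alpha>) \<bullet> v"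
    by (rule transpose_vec_mult_scalar[symmetric, OF T v qvec_carrier[OF M]])
  then show ?thesis
    using v by (simp add: scalar_prod_def lessThan_atLeast0 mult.commute)
qed

lemma eta_cube_point:
  assumes M: "btl_setting M" and T: "T \<in> carrier_mat (par_dim M) (par_dim M)"
  shows "eta M \<alpha> (cube_point M T \<delta> S) = w_o M \<bullet> contrast M \<alpha> / scale M
    + (\<Sum>i<par_dim M. rademacher S i * (\<delta> * (T\<^sup>T *\<^sub>v qvec M \<alpha>) $ i))"
proof -
  have s: "scale M > 0" using M by (simp add: btl_setting_def)
  let ?v = "vec (par_dim M) (rademacher S)"
  have "qvec M \<alpha> \<bullet> cube_point M T \<delta> S = scale M * \<delta> * (qvec M \<alpha> \<bullet> (T *\<^sub>v ?v))"
    unfolding cube_point_def using T qvec_carrier[OF M]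
    by (intro scalar_prod_smult_distrib[of _ "par_dim M"]) auto
  also have "\<dots> = scale M * (\<Sum>i<par_dim M. rademacher S i * (\<delta> * (T\<^sup>T *\<^sub>v qvec M \<alpha>) $ i))"
    by (simp add: qvec_mult_mat[OF M T] sum_distrib_left mult_ac)
  finally show ?thesis
    using s by (simp add: eta_def add_divide_distrib)
qed

text \<open>By \<open>TWT\<close> the map \<open>T\<close> turns the quadratic form into the
  Euclidean one, and a difference of sign vectors has entries 0, 2 or -2.\<close>

lemma pred_dist_cube_point:
  assumes M: "btl_setting M" and T: "T \<in> carrier_mat (par_dim M) (par_dim M)"
    and TWT: "T\<^sup>T * (design_mat M * T) = 1\<^sub>m (par_dim M)"
  shows "pred_dist M (cube_point M T \<delta> S) (cube_point M T \<delta> S')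
    = 4 * \<delta>\<^sup>2 * real (card {i \<in> {..<par_dim M}. (i \<in> S) \<noteq> (i \<in> S')})"
proof -
  let ?n = "par_dim M" and ?W = "design_mat M"
  define c where "c = vec ?n (\<lambda>i. rademacher S i - rademacher S' i)"
  have c: "c \<in> carrier_vec ?n" by (simp add: c_def)
  have Tc: "T *\<^sub>v c \<in> carrier_vec ?n" using T c by simp
  have "eta M \<alpha> (cube_point M T \<delta> S) - eta M \<alpha> (cube_point M T \<delta> S') = \<delta> * (qvec M \<alpha> \<bullet> (T *\<^sub>v c))" for \<alpha>
    by (simp add: eta_cube_point[OF M T] qvec_mult_mat[OF M T c])
       (simp add: c_def left_diff_distrib sum_subtractf sum_distrib_left right_diff_distrib mult_ac)
  then have "pred_dist M (cube_point M T \<delta> S) (cube_point M T \<delta> S')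
      = \<delta>\<^sup>2 * ((T *\<^sub>v c) \<bullet> (?W *\<^sub>v (T *\<^sub>v c)))"
    by (simp add: pred_dist_def design_mat_quadratic_form[OF M Tc] power_mult_distrib
        sum_distrib_left mult_ac)
  also have "(T *\<^sub>v c) \<bullet> (?W *\<^sub>v (T *\<^sub>v c)) = c \<bullet> (T\<^sup>T *\<^sub>v (?W *\<^sub>v (T *\<^sub>v c)))"
  proof -
    have WTc: "?W *\<^sub>v (T *\<^sub>v c) \<in> carrier_vec ?n"
      using Tc design_mat_carrier by (rule mult_mat_vec_carrier[rotated])
    show ?thesis
      using transpose_vec_mult_scalar[OF T c WTc] comm_scalar_prod[OF Tc WTc]
        comm_scalar_prod[OF c, of "T\<^sup>T *\<^sub>v (?W *\<^sub>v (T *\<^sub>v c))"] T WTc by simp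
  qed
  also have "T\<^sup>T *\<^sub>v (?W *\<^sub>v (T *\<^sub>v c)) = (T\<^sup>T * (?W * T)) *\<^sub>v c"
    using T c design_mat_carrier[of M] by (simp add: assoc_mult_mat_vec[of _ ?n ?n _ ?n])
  also have "\<dots> = c" using c by (simp add: TWT)
  also have "c \<bullet> c = (\<Sum>i<?n. 4 * of_bool ((i \<in> S) \<noteq> (i \<in> S')))"
    unfolding scalar_prod_def c_def lessThan_atLeast0
    by (intro sum.cong) (auto simp: rademacher_def)
  also have "\<dots> = 4 * real (card {i \<in> {..<?n}. (i \<in> S) \<noteq> (i \<in> S')})"
    by (simp add: Int_def flip: sum_distrib_left)
  finally show ?thesis by simp
qed

text \<open>As \<open>T * T\<^sup>T\<close> inverts the design matrix, the left side is the leverage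
  of the query. Times \<open>\<delta>\<^sup>2\<close> it is the variance of the random part of
  \<open>eta\<close> at a uniformly random vertex.\<close>

lemma leverage_le_coherence:
  assumes M: "btl_setting M" and T: "T \<in> carrier_mat (par_dim M) (par_dim M)"
    and TWT: "T\<^sup>T * (design_mat M * T) = 1\<^sub>m (par_dim M)" and \<alpha>: "\<alpha> \<in> queries M"
  shows "(\<Sum>i<par_dim M. ((T\<^sup>T *\<^sub>v qvec M \<alpha>) $ i)\<^sup>2) \<le> coherence M * real (par_dim M)"
proof -
  let ?n = "par_dim M" and ?q = "qvec M \<alpha>"
  have n: "?n > 0" using M by (simp add: btl_setting_def)
  have q: "?q \<in> carrier_vec ?n" by (rule qvec_carrier[OF M])
  then have Tq: "T\<^sup>T *\<^sub>v ?q \<in> carrier_vec ?n" using T by simp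
  have "(\<Sum>i<?n. ((T\<^sup>T *\<^sub>v ?q) $ i)\<^sup>2) = (T\<^sup>T *\<^sub>v ?q) \<bullet> (T\<^sup>T *\<^sub>v ?q)"
    using T by (simp add: scalar_prod_def lessThan_atLeast0 power2_eq_square)
  also have "\<dots> = ?q \<bullet> ((T * T\<^sup>T) *\<^sub>v ?q)"
    using transpose_vec_mult_scalar[OF T Tq q] T q by (simp add: assoc_mult_mat_vec[of _ ?n ?n _ ?n])
  also have "\<dots> = (1 / real ?n * (?q \<bullet> (the (mat_inverse (design_mat M)) *\<^sub>v ?q))) * real ?n"
    using n by (simp add: orthonormal_mat_inverse[OF design_mat_carrier T TWT])
  also have "\<dots> \<le> coherence M * real ?n"
    unfolding coherence_def using \<alpha> finite_queries[OF M]
    by (intro mult_right_mono Max_ge) auto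
  finally show ?thesis .
qed

section \<open>Most vertices lie in the parameter set\<close>

lemma offset_le_B0:
  assumes "btl_setting M" and "\<alpha> \<in> queries M"
  shows "\<bar>w_o M \<bullet> contrast M \<alpha> / scale M\<bar> \<le> ln (B0 M)"
  unfolding B0_def ln_exp using finite_queries[OF assms(1)] assms(2) by (intro Max_ge) auto

definition admissible :: "btl \<Rightarrow> real \<Rightarrow> real mat \<Rightarrow> real \<Rightarrow> nat set set" where
  "admissible M B T \<delta> = {S. S \<subseteq> {..<par_dim M} \<and> cube_point M T \<delta> S \<in> par_set M B}"

text \<open>Union bound over the queries: outside the parameter set some Rademacher sum exceeds
  \<open>ln (B / B0 M)\<close>, the part of \<open>ln B\<close> left by the largest offset.\<close>

lemma card_inadmissible:
  assumes M: "btl_setting M" and T: "T \<in> carrier_mat (par_dim M) (par_dim M)"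
    and TWT: "T\<^sup>T * (design_mat M * T) = 1\<^sub>m (par_dim M)" and B: "B0 M < B"
    and \<delta>: "\<delta>\<^sup>2 * (4 * coherence M * real (par_dim M) * ln (4 * real (n_items M))) \<le> (ln (B / B0 M))\<^sup>2"
  shows "real (card (Pow {..<par_dim M} - admissible M B T \<delta>)) \<le> 2 ^ par_dim M / 16"
proof -
  let ?n = "par_dim M" and ?d = "real (n_items M)" and ?Q = "queries M"
  define L where "L = ln (B / B0 M)"
  define k where "k = ln (4 * ?d)"
  define z where "z \<alpha> i = \<delta> * (T\<^sup>T *\<^sub>v qvec M \<alpha>) $ i" for \<alpha> i
  define bad where "bad \<alpha> = {S \<in> Pow {..<?n}. L < \<bar>\<Sum>i<?n. rademacher S i * z \<alpha> i\<bar>}" for \<alpha>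
  have B0: "0 < B0 M" by (simp add: B0_def)
  have L: "0 < L" using B B0 by (simp add: L_def)
  have LB: "ln (B0 M) + L = ln B" using B B0 by (simp add: L_def ln_div)
  have d: "2 \<le> ?d" using M by (simp add: btl_setting_def)
  then have k: "0 < k" by (simp add: k_def)
  have card_bad: "real (card (bad \<alpha>)) \<le> 2 ^ ?n / (8 * ?d\<^sup>2)" if \<alpha>: "\<alpha> \<in> ?Q" for \<alpha>
  proof -
    let ?s = "\<Sum>i<?n. (z \<alpha> i)\<^sup>2"
    txt \<open>The Chernoff parameter is optimal only in the extreme case \<open>?s * (4 * k) = L\<^sup>2\<close>,
      but unlike \<open>L / ?s\<close> it needs no separate treatment of \<open>?s = 0\<close>.\<close>
    let ?l = "4 * k / L"
    have "?s = \<delta>\<^sup>2 * (\<Sum>i<?n. ((T\<^sup>T *\<^sub>v qvec M \<alpha>) $ i)\<^sup>2)"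
      by (simp add: z_def power_mult_distrib sum_distrib_left)
    also have "\<dots> \<le> \<delta>\<^sup>2 * (coherence M * real ?n)"
      by (intro mult_left_mono leverage_le_coherence[OF M T TWT \<alpha>]) simp
    finally have "?s * (4 * k) \<le> \<delta>\<^sup>2 * (coherence M * real ?n) * (4 * k)"
      using k by (intro mult_right_mono) auto
    also have "\<dots> \<le> L\<^sup>2" using \<delta> by (simp add: L_def k_def mult_ac)
    finally have s: "?s * (4 * k) \<le> L\<^sup>2" .
    have "?l\<^sup>2 * ?s / 2 = (?s * (4 * k)) * (2 * k / L\<^sup>2)"
      by (simp add: power2_eq_square field_simps)
    also have "\<dots> \<le> L\<^sup>2 * (2 * k / L\<^sup>2)" using s k by (intro mult_right_mono) auto
    also have "\<dots> = 2 * k" using L by simp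
    finally have "?l\<^sup>2 * ?s / 2 - ?l * L \<le> - (2 * k)" using L by simp
    then have "exp (?l\<^sup>2 * ?s / 2 - ?l * L) \<le> exp (- (2 * k))" by simp
    \<comment> \<open>The 4 inside the logarithm produces this 16. The two tails contribute a factor
      2 and the number of queries at most \<open>?d\<^sup>2 / 2\<close>, so a fraction 1/16
      remains.\<close>
    also have "\<dots> = 1 / (16 * ?d\<^sup>2)"
    proof -
      have "exp (2 * k) = (4 * ?d)\<^sup>2" using d by (simp add: k_def exp_double)
      then show ?thesis by (simp add: exp_minus field_simps power2_eq_square)
    qed
    finally have e: "exp (?l\<^sup>2 * ?s / 2 - ?l * L) \<le> 1 / (16 * ?d\<^sup>2)" .
    have "real (card (bad \<alpha>)) \<le> 2 * 2 ^ card {..<?n} * exp (?l\<^sup>2 * ?s / 2 - ?l * L)"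
      unfolding bad_def by (rule card_rademacher_gt_le) (use k L in auto)
    also have "\<dots> \<le> 2 * 2 ^ ?n * (1 / (16 * ?d\<^sup>2))"
      using mult_left_mono[OF e, of "2 * 2 ^ ?n"] by simp
    finally show ?thesis by simp
  qed
  have "Pow {..<?n} - admissible M B T \<delta> \<subseteq> (\<Union>\<alpha>\<in>?Q. bad \<alpha>)"
  proof
    fix S assume S: "S \<in> Pow {..<?n} - admissible M B T \<delta>"
    then have "cube_point M T \<delta> S \<notin> par_set M B" by (simp add: admissible_def)
    then obtain \<alpha> where \<alpha>: "\<alpha> \<in> ?Q" "\<not> \<bar>eta M \<alpha> (cube_point M T \<delta> S)\<bar> \<le> ln B"
      using cube_point_carrier[OF T] by (auto simp: par_set_def)
    have "L < \<bar>\<Sum>i<?n. rademacher S i * z \<alpha> i\<bar>"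
      using \<alpha>(2) offset_le_B0[OF M \<alpha>(1)] LB
      unfolding eta_cube_point[OF M T] z_def by linarith
    then have "S \<in> bad \<alpha>" using S by (simp add: bad_def)
    with \<alpha>(1) show "S \<in> (\<Union>\<alpha>\<in>?Q. bad \<alpha>)" by blast
  qed
  then have "card (Pow {..<?n} - admissible M B T \<delta>) \<le> card (\<Union>\<alpha>\<in>?Q. bad \<alpha>)"
    by (rule card_mono[rotated]) (simp add: finite_queries[OF M] bad_def)
  also have "\<dots> \<le> (\<Sum>\<alpha>\<in>?Q. card (bad \<alpha>))"
    by (rule card_UN_le[OF finite_queries[OF M]])
  finally have "real (card (Pow {..<?n} - admissible M B T \<delta>)) \<le> (\<Sum>\<alpha>\<in>?Q. real (card (bad \<alpha>)))"
    by (metis of_nat_le_iff of_nat_sum)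
  also have "\<dots> \<le> (\<Sum>\<alpha>\<in>?Q. 2 ^ ?n / (8 * ?d\<^sup>2))" by (rule sum_mono[OF card_bad])
  also have "\<dots> = (2 * real (card ?Q)) * (2 ^ ?n / (16 * ?d\<^sup>2))" by simp
  also have "\<dots> \<le> ?d\<^sup>2 * (2 ^ ?n / (16 * ?d\<^sup>2))"
  proof (rule mult_right_mono)
    have "real (2 * card ?Q) \<le> real ((n_items M)\<^sup>2)"
      using card_queries_le[OF M] by (simp only: of_nat_le_iff)
    then show "2 * real (card ?Q) \<le> ?d\<^sup>2" by simp
  qed simp
  also have "\<dots> = 2 ^ ?n / 16" using d by simp
  finally show ?thesis .
qed

text \<open>The rate will be the squared step \<open>\<delta>\<^sup>2\<close>. The second bound
  keeps neighbouring vertices statistically close; the third keeps most of the cube in the parameter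
  set.\<close>

lemma rate_bounds:
  assumes M: "btl_setting M" and W: "pos_def_mat (par_dim M) (design_mat M)"
  shows "0 \<le> rate M B" "rate M B * real (n_obs M) \<le> 1"
    "rate M B * (4 * coherence M * real (par_dim M) * ln (4 * real (n_items M))) \<le> (ln (B / B0 M))\<^sup>2"
proof -
  obtain T where T: "T \<in> carrier_mat (par_dim M) (par_dim M)" "T\<^sup>T * (design_mat M * T) = 1\<^sub>m (par_dim M)"
    using pos_def_orthonormal_mat[OF W] .
  obtain \<alpha> where \<alpha>: "\<alpha> \<in> queries M" using M by (auto simp: btl_setting_def)
  define X where "X = 4 * coherence M * real (par_dim M) * ln (4 * real (n_items M))"
  have "0 \<le> (\<Sum>i<par_dim M. ((T\<^sup>T *\<^sub>v qvec M \<alpha>) $ i)\<^sup>2)" by (simp add: sum_nonneg)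
  also have "\<dots> \<le> coherence M * real (par_dim M)" by (rule leverage_le_coherence[OF M T \<alpha>])
  finally have "0 \<le> coherence M * real (par_dim M)" .
  moreover have "0 \<le> 4 * ln (4 * real (n_items M))" using M by (simp add: btl_setting_def)
  ultimately have "0 \<le> coherence M * real (par_dim M) * (4 * ln (4 * real (n_items M)))"
    by (rule mult_nonneg_nonneg)
  then have X: "0 \<le> X" by (simp add: X_def mult_ac)
  then show "0 \<le> rate M B" by (simp add: rate_def flip: X_def)
  have "rate M B \<le> 1 / real (n_obs M)" by (simp add: rate_def)
  then show "rate M B * real (n_obs M) \<le> 1" using n_obs_pos[OF M] by (simp add: field_simps)
  have "rate M B \<le> (ln (B / B0 M))\<^sup>2 / X" by (simp add: rate_def X_def)
  then show "rate M B * (4 * coherence M * real (par_dim M) * ln (4 * real (n_items M))) \<le> (ln (B / B0 M))\<^sup>2"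
    \<comment> \<open>For \<open>X = 0\<close> the left side vanishes.\<close>
    using X unfolding X_def[symmetric] by (cases "X = 0") (simp_all add: field_simps)
qed

text \<open>For Hamming distance H, \<open>excess_pair\<close> bounds
  \<open>4 * \<delta>\<^sup>2 * H / (16 * B)\<close> by the sum of the two excess risks; the
  constant 128 is what makes this give H below 1/16 of the dimension.\<close>

lemma admissible_near:
  assumes M: "btl_setting M" and T: "T \<in> carrier_mat (par_dim M) (par_dim M)"
    and TWT: "T\<^sup>T * (design_mat M * T) = 1\<^sub>m (par_dim M)" and B: "1 < B"
    and S: "S \<in> admissible M B T \<delta>" "S' \<in> admissible M B T \<delta>"
    and lt: "excess M v (cube_point M T \<delta> S) < real (par_dim M) / (128 * B) * \<delta>\<^sup>2"
      "excess M v (cube_point M T \<delta> S') < real (par_dim M) / (128 * B) * \<delta>\<^sup>2"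
  shows "real (card {i \<in> {..<par_dim M}. (i \<in> S) \<noteq> (i \<in> S')}) < 1 / 16 * real (par_dim M)"
proof -
  let ?H = "real (card {i \<in> {..<par_dim M}. (i \<in> S) \<noteq> (i \<in> S')})"
  have "4 * \<delta>\<^sup>2 * ?H / (16 * B)
      \<le> excess M v (cube_point M T \<delta> S) + excess M v (cube_point M T \<delta> S')"
    using excess_pair[OF M B, of "cube_point M T \<delta> S" "cube_point M T \<delta> S'"] S
    by (simp add: admissible_def pred_dist_cube_point[OF M T TWT])
  also have "\<dots> < 2 * (real (par_dim M) / (128 * B) * \<delta>\<^sup>2)" using lt by simp
  finally have "\<delta>\<^sup>2 / B * (4 * ?H / 16) < \<delta>\<^sup>2 / B * (real (par_dim M) / 64)"
    using B by (simp add: field_simps)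
  then have "4 * ?H / 16 < real (par_dim M) / 64"
    using B by (elim mult_left_less_imp_less) simp
  then show ?thesis by simp
qed

subsection \<open>The minimax bounds\<close>

lemma minimax_prob:
  assumes M: "btl_setting M" and B1: "1 < B" and B: "B0 M < B"
    and W: "pos_def_mat (par_dim M) (design_mat M)"
  obtains \<theta> where "\<theta> \<in> par_set M B"
    "1 / 15 \<le> measure_pmf.prob (resp_pmf M \<theta>)
       {y. excess M (h y) \<theta> \<ge> real (par_dim M) / (128 * B) * rate M B}"
proof -
  let ?n = "par_dim M"
  define thr where "thr = real ?n / (128 * B) * rate M B"
  define \<delta> where "\<delta> = sqrt (rate M B)"
  have \<delta>2: "\<delta>\<^sup>2 = rate M B" using rate_bounds(1)[OF M W] by (simp add: \<delta>_def)
  have n: "?n > 0" using M by (simp add: btl_setting_def)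
  obtain T where T: "T \<in> carrier_mat ?n ?n" and TWT: "T\<^sup>T * (design_mat M * T) = 1\<^sub>m ?n"
    using pos_def_orthonormal_mat[OF W] .
  define G where "G = admissible M B T \<delta>"
  define th where "th S = cube_point M T \<delta> S" for S
  define P where "P S = measure_pmf.prob (resp_pmf M (th S)) {y. thr \<le> excess M (h y) (th S)}" for S
  have G: "G \<subseteq> Pow {..<?n}" "finite G"
    by (auto simp: G_def admissible_def intro: finite_subset[of _ "Pow {..<?n}"])
  have bad: "real (card (Pow {..<?n} - G)) \<le> 2 ^ ?n / 16"
    unfolding G_def by (rule card_inadmissible[OF M T TWT B]) (use rate_bounds(3)[OF M W] \<delta>2 in simp)
  txt \<open>An estimator is turned into a decoder of sign vectors; if no admissible parameter has
    small excess risk, its value \<open>SOME\<close> is arbitrary, and not used.\<close>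
  define g where "g y = (SOME S. S \<in> G \<and> excess M (h y) (th S) < thr)" for y
  define Q where "Q S = measure_pmf.prob (resp_pmf M (th S))
      {y. 1 / 16 * real (card {..<?n}) \<le> real (card {i \<in> {..<?n}. (i \<in> g y) \<noteq> (i \<in> S)})}" for S
  \<comment> \<open>If the excess risk at \<open>S\<close> were below \<open>thr\<close>, then
    \<open>S\<close> and \<open>g y\<close> would both be admissible with small excess risk at
    \<open>h y\<close>, hence close. So many wrong signs force a large excess risk at
    \<open>S\<close>.\<close>
  have QP: "Q S \<le> P S" if S: "S \<in> G" for S
    unfolding Q_def P_def
  proof (rule measure_pmf.finite_measure_mono)
    show "{y. 1 / 16 * real (card {..<?n}) \<le> real (card {i \<in> {..<?n}. (i \<in> g y) \<noteq> (i \<in> S)})}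
        \<subseteq> {y. thr \<le> excess M (h y) (th S)}"
    proof (clarify, rule ccontr)
      fix y assume H: "1 / 16 * real (card {..<?n}) \<le> real (card {i \<in> {..<?n}. (i \<in> g y) \<noteq> (i \<in> S)})"
        and "\<not> thr \<le> excess M (h y) (th S)"
      then have lt: "excess M (h y) (th S) < thr" by simp
      have "g y \<in> G \<and> excess M (h y) (th (g y)) < thr"
        unfolding g_def by (rule someI[of _ S]) (use S lt in simp)
      then have "real (card {i \<in> {..<?n}. (i \<in> g y) \<noteq> (i \<in> S)}) < 1 / 16 * real ?n"
        using S lt unfolding G_def th_def thr_def \<delta>2[symmetric]
        by (intro admissible_near[OF M T TWT B1, where v = "h y" and \<delta> = \<delta>]) blast+
      with H show False by simp
    qed
  qed simp
  \<comment> \<open>Neighbours are at squared distance \<open>4 * rate M B\<close>, and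
    \<open>rate M B * n_obs M\<close> is at most 1, so the exponent is at least -4/32. This holds on
    the whole cube, where Assouad's bound is applied.\<close>
  have aff: "exp (- (1 / 8)) \<le> (\<Sum>y\<in>resp_space M. sqrt (pmf (resp_pmf M (th S)) y * pmf (resp_pmf M (th (insert i S))) y))"
    if "i \<in> {..<?n}" "i \<notin> S" for S i
  proof -
    have "{j \<in> {..<?n}. (j \<in> S) \<noteq> (j \<in> insert i S)} = {i}" using that by auto
    then have "pred_dist M (th S) (th (insert i S)) = 4 * rate M B"
      by (simp add: th_def pred_dist_cube_point[OF M T TWT] \<delta>2)
    then have "exp (- (1 / 8)) \<le> exp (- (real (n_obs M) * pred_dist M (th S) (th (insert i S)) / 32))"
      using rate_bounds(2)[OF M W] by (simp add: mult.commute)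
    also note resp_affinity[OF M]
    finally show ?thesis .
  qed
  have "2 ^ ?n * ((exp (- (1 / 8)))\<^sup>2 / 4 - 1 / 16) \<le> (\<Sum>S\<in>Pow {..<?n}. Q S)"
    using assouad_prob[where A = "{..<?n}" and P = "\<lambda>S. resp_pmf M (th S)" and r = "exp (- (1 / 8))"
        and t = "1 / 16" and g = g and \<Omega> = "resp_space M"] n
      finite_resp_space[OF M] set_resp_pmf[OF M] aff by (simp add: Q_def lessThan_empty_iff)
  also have "\<dots> = (\<Sum>S\<in>Pow {..<?n} - G. Q S) + (\<Sum>S\<in>G. Q S)"
    by (rule sum.subset_diff[OF G(1)]) simp
  \<comment> \<open>Inadmissible vertices are charged the trivial probability 1 and cost at most
    1/16 of the cube.\<close>
  also have "(\<Sum>S\<in>Pow {..<?n} - G. Q S) \<le> (\<Sum>S\<in>Pow {..<?n} - G. 1)"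
    by (rule sum_mono) (simp add: Q_def)
  also have "\<dots> \<le> 2 ^ ?n / 16" using bad by simp
  finally have low: "2 ^ ?n * ((exp (- (1 / 8)))\<^sup>2 / 4 - 1 / 16) \<le> 2 ^ ?n / 16 + (\<Sum>S\<in>G. Q S)"
    by simp
  have "(15 / 16) ^ 4 \<le> (exp (- (1 / 16)) :: real) ^ 4"
    using exp_ge_add_one_self[of "- (1 / 16) :: real"] by (intro power_mono) auto
  also have "\<dots> = (exp (- (1 / 8)))\<^sup>2"
    by (simp flip: exp_of_nat_mult)
  finally have "1 / 15 + 1 / 8 \<le> (exp (- (1 / 8)) :: real)\<^sup>2 / 4"
    by (simp add: power_divide)
  then have "2 ^ ?n * (1 / 15 + 1 / 8) \<le> 2 ^ ?n * ((exp (- (1 / 8)) :: real)\<^sup>2 / 4)"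
    by (rule mult_left_mono) simp
  then have "2 ^ ?n * (1 / 15) \<le> (\<Sum>S\<in>G. Q S)"
    using low unfolding distrib_left right_diff_distrib by linarith
  also have "\<dots> \<le> (\<Sum>S\<in>G. P S)" by (rule sum_mono[OF QP])
  finally have sumP: "2 ^ ?n * (1 / 15) \<le> (\<Sum>S\<in>G. P S)" .
  have "\<exists>S\<in>G. 1 / 15 \<le> P S"
  proof (rule ccontr)
    assume "\<not> ?thesis"
    then have less: "P S < 1 / 15" if "S \<in> G" for S using that by force
    have "G \<noteq> {}"
    proof
      assume "G = {}"
      then have "2 ^ ?n * (1 / 15 :: real) \<le> 0" using sumP by simp
      then show False using zero_less_power[of "2 :: real" ?n] by linarith
    qed
    then have "(\<Sum>S\<in>G. P S) < (\<Sum>S\<in>G. 1 / 15)" using less G(2) by (intro sum_strict_mono) auto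
    also have "\<dots> \<le> 2 ^ ?n * (1 / 15)"
    proof -
      have "card G \<le> card (Pow {..<?n})" by (rule card_mono[OF _ G(1)]) simp
      then have "card G \<le> 2 ^ ?n" by (simp add: card_Pow)
      then have "real (card G) \<le> 2 ^ ?n" by (metis of_nat_le_iff of_nat_numeral of_nat_power)
      then show ?thesis by simp
    qed
    finally show False using sumP by simp
  qed
  then obtain S where "S \<in> G" "1 / 15 \<le> P S" by blast
  then show thesis
    by (intro that[of "th S"]) (simp_all add: G_def th_def P_def admissible_def thr_def)
qed

lemma prob_le_risk:
  assumes M: "btl_setting M" and t: "0 \<le> t"
  shows "t * measure_pmf.prob (resp_pmf M \<theta>) {y. t \<le> excess M (h y) \<theta>} \<le> risk M h \<theta>"
proof -
  have "t * measure_pmf.prob (resp_pmf M \<theta>) {y. t \<le> excess M (h y) \<theta>}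
      = measure_pmf.expectation (resp_pmf M \<theta>) (\<lambda>y. t * indicator {y. t \<le> excess M (h y) \<theta>} y)"
    by simp
  also have "\<dots> \<le> measure_pmf.expectation (resp_pmf M \<theta>) (\<lambda>y. excess M (h y) \<theta>)"
    by (rule integral_mono) (auto simp: integrable_resp_pmf[OF M] indicator_def excess_nonneg[OF M])
  finally show ?thesis by (simp add: risk_def)
qed

theorem corollary3p2:
  shows "\<exists>c0 > (0 :: real). \<forall>(M :: btl) (B :: real).
    btl_setting M \<longrightarrow> B > 1 \<longrightarrow> B > B0 M \<longrightarrow> pos_def_mat (par_dim M) (design_mat M) \<longrightarrow>
      (INF h \<in> estimators M B. SUP \<theta> \<in> par_set M B. ereal (risk M h \<theta>))
        \<ge> ereal (c0 * (real (par_dim M) / B) * rate M B) \<and>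
      (INF h \<in> estimators M B. SUP \<theta> \<in> par_set M B.
         ereal (measure_pmf.prob (resp_pmf M \<theta>)
           {y. excess M (h y) \<theta> \<ge> real (par_dim M) / (128 * B) * rate M B}))
        \<ge> ereal (1 / 15)"
proof (intro exI[of _ "1 / 1920"] conjI allI impI INF_greatest)
  fix M :: btl and B :: real and h
  assume M: "btl_setting M" and B: "B > 1" "B > B0 M" and W: "pos_def_mat (par_dim M) (design_mat M)"
  let ?thr = "real (par_dim M) / (128 * B) * rate M B"
  obtain \<theta> where \<theta>: "\<theta> \<in> par_set M B"
    "1 / 15 \<le> measure_pmf.prob (resp_pmf M \<theta>) {y. excess M (h y) \<theta> \<ge> ?thr}"
    using minimax_prob[OF M B W] .
  show "ereal (1 / 15) \<le> (SUP \<theta>\<in>par_set M B.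
      ereal (measure_pmf.prob (resp_pmf M \<theta>) {y. excess M (h y) \<theta> \<ge> ?thr}))"
    by (rule SUP_upper2[OF \<theta>(1)]) (use \<theta>(2) in simp)
  have thr: "0 \<le> ?thr" using B rate_bounds(1)[OF M W] by simp
  have "1 / 1920 * (real (par_dim M) / B) * rate M B = ?thr * (1 / 15)" by simp
  also have "\<dots> \<le> ?thr * measure_pmf.prob (resp_pmf M \<theta>) {y. excess M (h y) \<theta> \<ge> ?thr}"
    using \<theta>(2) thr by (rule mult_left_mono)
  also have "\<dots> \<le> risk M h \<theta>" by (rule prob_le_risk[OF M thr])
  finally show "ereal (1 / 1920 * (real (par_dim M) / B) * rate M B)
      \<le> (SUP \<theta>\<in>par_set M B. ereal (risk M h \<theta>))"
    by (intro SUP_upper2[OF \<theta>(1)]) simp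
qed simp

end
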